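(* Let $K\subset\mathbb{R}^2$ be a (non-degenerate) parallelogram with set of edges $\mathcal{E}_K$ and set of vertices $\mathcal{V}_K$, and let $\mathbb{X}_\square(K)=\operatorname{sym}(\boldsymbol Q^0(K)\otimes\boldsymbol{RT}^1(K))$. The following degrees of freedom (linear functionals of $\boldsymbol M\in\mathbb{X}_\square(K)$) are unisolvent for $\mathbb{X}_\square(K)$, i.e., every $\boldsymbol M\in\mathbb{X}_\square(K)$ is uniquely determined by their values and all values can be prescribed arbitrarily: (i) the moments $\frac{1}{\|\ell_{E,k}\|_E^2}\langle \mathrm{tr}_{K,E,\boldsymbol n}\boldsymbol M,\ell_{E,k}\rangle_E$ for $k=0,1$ and all $E\in\mathcal{E}_K$; (ii) the moments $\langle \mathrm{tr}_{K,E,\boldsymbol t}\boldsymbol M,\ell_{E,k}\rangle_E$ for $k=0,1$ and all $E\in\mathcal{E}_K$; (iii) the values $[\boldsymbol t\cdot\boldsymbol M\boldsymbol n]_{\partial K}(z)$ for all $z\in\mathcal{V}_K$.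
   Context: $P^p(K)$: polynomials of (total) degree $\le p$; $P^p_{\mathrm{hom}}(K)$: homogeneous polynomials of degree $p$; $\boldsymbol x$ denotes the function $(x,y)\mapsto(x,y)^\top$; $\boldsymbol{RT}^p(K)=P^p(K)^2\oplus\boldsymbol xP^p_{\mathrm{hom}}(K)$ (also for parallelograms). $\operatorname{sym}(\boldsymbol M)=\frac12(\boldsymbol M+\boldsymbol M^\top)$ (applied to spaces: image), $\boldsymbol X\otimes\boldsymbol Y=\operatorname{span}\{\boldsymbol\phi\boldsymbol\psi^\top:\boldsymbol\phi\in\boldsymbol X,\boldsymbol\psi\in\boldsymbol Y\}$. $\widehat K=(0,1)^2$. For $K$ with vertices $\boldsymbol a_K,\boldsymbol b_K,\boldsymbol d_K,\boldsymbol c_K$ in positive order, $F_K(\widehat{\boldsymbol x})=\boldsymbol B_K\widehat{\boldsymbol x}+\boldsymbol a_K$ with $\boldsymbol B_K=(\boldsymbol b_K-\boldsymbol a_K\;\;\boldsymbol c_K-\boldsymbol a_K)$, and the Piola transformation is $\boldsymbol\phi=\mathcal{P}_K(\widehat{\boldsymbol\phi})$ with $\det(\boldsymbol B_K)\,\boldsymbol\phi\circ F_K=\boldsymbol B_K\widehat{\boldsymbol\phi}$. $\boldsymbol Q^0(\widehat K)=P^0(\widehat K)^2\oplus\operatorname{span}\{(x,0)^\top,(0,y)^\top\}$, $\boldsymbol Q^0(K)=\mathcal{P}_K(\boldsymbol Q^0(\widehat K))$. $\boldsymbol n$, $\boldsymbol t$: unit exterior normal and unit tangent (positive orientation) along $\partial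 K$; edges are oriented accordingly. $\mathrm{tr}_{K,E,\boldsymbol n}\boldsymbol M=\boldsymbol n\cdot\boldsymbol M\boldsymbol n|_E$ and $\mathrm{tr}_{K,E,\boldsymbol t}\boldsymbol M=(\boldsymbol n\cdot\mathbf{div}\boldsymbol M+\partial_{\boldsymbol t}(\boldsymbol t\cdot\boldsymbol M\boldsymbol n))|_E$, with $\mathbf{div}$ the row-wise divergence. For a vertex $z$ that is the end point of edge $E$ and the starting point of edge $E'$, $[\boldsymbol t\cdot\boldsymbol M\boldsymbol n]_{\partial K}(z)=(\boldsymbol t\cdot\boldsymbol M\boldsymbol n)|_E(z)-(\boldsymbol t\cdot\boldsymbol M\boldsymbol n)|_{E'}(z)$. $\ell_{E,k}\in P^k(E)$ is the Legendre polynomial of degree $k$ on $E$, normalized to have value $1$ at the end point of $E$. $\langle\cdot,\cdot\rangle_E$ and $\|\cdot\|_E$ are the $L_2(E)$ inner product and norm. *)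

theory Defs
  imports "HOL-Analysis.Analysis" "HOL-Library.Function_Algebras"
begin

text \<open>
  Functions into a real vector space form a real vector space under the pointwise operations, so
  that the library's \<^const>\<open>span\<close> applies to function spaces.
\<close>

instantiation "fun" :: (type, real_vector) real_vector
begin

definition scaleR_fun :: "real \<Rightarrow> ('a \<Rightarrow> 'b) \<Rightarrow> 'a \<Rightarrow> 'b"
  where "scaleR_fun r f = (\<lambda>x. r *\<^sub>R f x)"

instance
  by standard (auto simp: scaleR_fun_def fun_eq_iff scaleR_add_left scaleR_add_right)

end

section \<open>Polynomial spaces\<close>

text \<open>
  Polynomials on the nonempty open set K are identified with the corresponding polynomial functions
  on the whole plane. This is one-to-one, and it is what gives meaning to their values and
  derivatives on the boundary of K.
\<close>

definition Pol :: "nat \<Rightarrow> (real^2 \<Rightarrow> real) set"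
  where "Pol p = span {(\<lambda>x. (x $ 1) ^ i * (x $ 2) ^ j) | i j. i + j \<le> p}"

definition Pol_hom :: "nat \<Rightarrow> (real^2 \<Rightarrow> real) set"
  where "Pol_hom p = span {(\<lambda>x. (x $ 1) ^ i * (x $ 2) ^ j) | i j. i + j = p}"

definition Pol_vec :: "nat \<Rightarrow> (real^2 \<Rightarrow> real^2) set"
  where "Pol_vec p = {\<phi>. \<forall>i. (\<lambda>x. \<phi> x $ i) \<in> Pol p}"

definition RT :: "nat \<Rightarrow> (real^2 \<Rightarrow> real^2) set"
  where "RT p = {(\<lambda>x. q x + s x *\<^sub>R x) | q s. q \<in> Pol_vec p \<and> s \<in> Pol_hom p}"

definition Q0_ref :: "(real^2 \<Rightarrow> real^2) set"
  where "Q0_ref = {(\<lambda>x. q x + r x) | q r.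
           q \<in> Pol_vec 0 \<and> r \<in> span {(\<lambda>x. vector [x $ 1, 0]), (\<lambda>x. vector [0, x $ 2])}}"

section \<open>Parallelograms\<close>

definition B_mat :: "real^2 \<Rightarrow> real^2 \<Rightarrow> real^2 \<Rightarrow> real^2^2"
  where "B_mat a b c = (\<chi> i j. if j = 1 then (b - a) $ i else (c - a) $ i)"

definition F_map :: "real^2 \<Rightarrow> real^2 \<Rightarrow> real^2 \<Rightarrow> real^2 \<Rightarrow> real^2"
  where "F_map a b c xh = B_mat a b c *v xh + a"

text \<open>
  a, b, d, c are the vertices, in positive (counterclockwise) order, of the nondegenerate
  parallelogram K, which is an open set.
\<close>

definition parallelogram ::
    "(real^2) set \<Rightarrow> real^2 \<Rightarrow> real^2 \<Rightarrow> real^2 \<Rightarrow> real^2 \<Rightarrow> bool"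
  where "parallelogram K a b d c \<longleftrightarrow>
           det (B_mat a b c) > 0 \<and> d - c = b - a \<and> K = F_map a b c ` box 0 1"

text \<open>An edge is an oriented segment, given by its starting point and its end point.\<close>

type_synonym edge = "(real^2) \<times> (real^2)"

definition edges :: "real^2 \<Rightarrow> real^2 \<Rightarrow> real^2 \<Rightarrow> real^2 \<Rightarrow> edge set"
  where "edges a b d c = {(a, b), (b, d), (d, c), (c, a)}"

definition verts :: "real^2 \<Rightarrow> real^2 \<Rightarrow> real^2 \<Rightarrow> real^2 \<Rightarrow> (real^2) set"
  where "verts a b d c = {a, b, d, c}"

definition piola :: "real^2 \<Rightarrow> real^2 \<Rightarrow> real^2 \<Rightarrow> (real^2 \<Rightarrow> real^2) \<Rightarrow> (real^2 \<Rightarrow> real^2) \<Rightarrow> bool"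
  where "piola a b c \<phi>h \<phi> \<longleftrightarrow>
           (\<forall>xh. det (B_mat a b c) *\<^sub>R \<phi> (F_map a b c xh) = B_mat a b c *v \<phi>h xh)"

definition Q0 :: "real^2 \<Rightarrow> real^2 \<Rightarrow> real^2 \<Rightarrow> (real^2 \<Rightarrow> real^2) set"
  where "Q0 a b c = {\<phi>. \<exists>\<phi>h \<in> Q0_ref. piola a b c \<phi>h \<phi>}"

section \<open>The tensor space\<close>

definition sym_mat :: "real^2^2 \<Rightarrow> real^2^2"
  where "sym_mat M = (1/2) *\<^sub>R (M + transpose M)"

definition tensor :: "(real^2 \<Rightarrow> real^2) set \<Rightarrow> (real^2 \<Rightarrow> real^2) set \<Rightarrow> (real^2 \<Rightarrow> real^2^2) set"
  where "tensor X Y = span {(\<lambda>x. \<chi> i j. \<phi> x $ i * \<psi> x $ j) | \<phi> \<psi>. \<phi> \<in> X \<and> \<psi> \<in> Y}"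

definition X_par :: "real^2 \<Rightarrow> real^2 \<Rightarrow> real^2 \<Rightarrow> (real^2 \<Rightarrow> real^2^2) set"
  where "X_par a b c = (\<lambda>M x. sym_mat (M x)) ` tensor (Q0 a b c) (RT 1)"

section \<open>Traces\<close>

definition tangent :: "edge \<Rightarrow> real^2"
  where "tangent E = (snd E - fst E) /\<^sub>R norm (snd E - fst E)"

text \<open>
  For a positively oriented boundary, turning the tangent clockwise by a right angle gives the
  exterior normal; see \<open>normal_exterior\<close> below.
\<close>

definition normal :: "edge \<Rightarrow> real^2"
  where "normal E = vector [tangent E $ 2, - tangent E $ 1]"

lemma normal_exterior:
  assumes K: "parallelogram K a b d c" and E: "E \<in> edges a b d c"
  shows "norm (normal E) = 1" "normal E \<bullet> tangent E = 0" "\<And>x. x \<in> K \<Longrightarrow> normal E \<bullet> (x - fst E) < 0"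
proof -
  define u w where "u = b - a" and "w = c - a"
  have D: "u $ 1 * w $ 2 - w $ 1 * u $ 2 > 0" and d: "d = b + c - a"
    and Kdef: "K = F_map a b c ` box 0 1"
    using K by (auto simp: parallelogram_def B_mat_def det_2 u_def w_def algebra_simps)
  have eqs: "b = a + u" "c = a + w" "d = a + u + w"
    by (auto simp: u_def w_def d algebra_simps)
  have ne: "snd E - fst E \<noteq> 0"
    using E D by (auto simp: edges_def eqs)
  have inner: "normal E \<bullet> y =
      ((snd E - fst E) $ 2 * y $ 1 - (snd E - fst E) $ 1 * y $ 2) / norm (snd E - fst E)" for y
    by (simp add: normal_def tangent_def inner_vec_def sum_2 divide_simps)
  have "norm (tangent E) = 1"
    using ne by (simp add: tangent_def)
  then show "norm (normal E) = 1"
    by (simp add: normal_def norm_eq_sqrt_inner inner_vec_def sum_2 add.commute)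
  show "normal E \<bullet> tangent E = 0"
    by (simp add: normal_def inner_vec_def sum_2)
  fix x assume "x \<in> K"
  then obtain y where y: "y \<in> box 0 1" and x: "x = F_map a b c y"
    by (auto simp: Kdef)
  have y01: "0 < y $ 1" "y $ 1 < 1" "0 < y $ 2" "y $ 2 < 1"
    using y by (auto simp: mem_box_cart)
  have xs: "x $ i = a $ i + y $ 1 * u $ i + y $ 2 * w $ i" for i
    by (simp add: x F_map_def B_mat_def matrix_vector_mult_def sum_2 u_def w_def algebra_simps)
  let ?D = "u $ 1 * w $ 2 - w $ 1 * u $ 2"
  have *: "(snd E - fst E) $ 2 * (x - fst E) $ 1 - (snd E - fst E) $ 1 * (x - fst E) $ 2
      \<in> {- y $ 2 * ?D, - (1 - y $ 1) * ?D, - (1 - y $ 2) * ?D, - y $ 1 * ?D}"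
    using E by (auto simp: edges_def eqs xs algebra_simps)
  have "(snd E - fst E) $ 2 * (x - fst E) $ 1 - (snd E - fst E) $ 1 * (x - fst E) $ 2 < 0"
  proof -
    have "\<forall>v \<in> {- y $ 2 * ?D, - (1 - y $ 1) * ?D, - (1 - y $ 2) * ?D, - y $ 1 * ?D}. v < 0"
      using y01 D by (simp add: mult_less_0_iff)
    with * show ?thesis by blast
  qed
  then show "normal E \<bullet> (x - fst E) < 0"
    using ne by (simp add: inner divide_neg_pos)
qed

definition dir_deriv :: "(real^2 \<Rightarrow> real) \<Rightarrow> real^2 \<Rightarrow> real^2 \<Rightarrow> real"
  where "dir_deriv f v x = frechet_derivative f (at x) v"

definition Div :: "(real^2 \<Rightarrow> real^2^2) \<Rightarrow> real^2 \<Rightarrow> real^2"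
  where "Div M x = (\<chi> i. \<Sum>j\<in>UNIV. dir_deriv (\<lambda>y. M y $ i $ j) (axis j 1) x)"

definition tr_n :: "edge \<Rightarrow> (real^2 \<Rightarrow> real^2^2) \<Rightarrow> real^2 \<Rightarrow> real"
  where "tr_n E M x = normal E \<bullet> (M x *v normal E)"

definition tMn :: "edge \<Rightarrow> (real^2 \<Rightarrow> real^2^2) \<Rightarrow> real^2 \<Rightarrow> real"
  where "tMn E M x = tangent E \<bullet> (M x *v normal E)"

definition tr_t :: "edge \<Rightarrow> (real^2 \<Rightarrow> real^2^2) \<Rightarrow> real^2 \<Rightarrow> real"
  where "tr_t E M x = normal E \<bullet> Div M x + dir_deriv (tMn E M) (tangent E) x"

definition vertex_jump ::
    "edge set \<Rightarrow> (real^2 \<Rightarrow> real^2^2) \<Rightarrow> real^2 \<Rightarrow> real"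
  where "vertex_jump Es M z =
           tMn (THE E. E \<in> Es \<and> snd E = z) M z - tMn (THE E'. E' \<in> Es \<and> fst E' = z) M z"

section \<open>Inner products and Legendre polynomials on edges\<close>

definition edge_point :: "edge \<Rightarrow> real \<Rightarrow> real^2"
  where "edge_point E s = fst E + s *\<^sub>R (snd E - fst E)"

text \<open>The factor in front of the integral makes this the integral with respect to arc length.\<close>

definition edge_inner :: "edge \<Rightarrow> (real^2 \<Rightarrow> real) \<Rightarrow> (real^2 \<Rightarrow> real) \<Rightarrow> real"
  where "edge_inner E f g = norm (snd E - fst E) *
           integral {0..1} (\<lambda>s. f (edge_point E s) * g (edge_point E s))"

definition edge_norm :: "edge \<Rightarrow> (real^2 \<Rightarrow> real) \<Rightarrow> real"
  where "edge_norm E f = sqrt (edge_inner E f f)"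

text \<open>The classical Legendre polynomials on \<open>[-1, 1]\<close>, with value 1 at 1 (Bonnet's recursion).\<close>

fun legendre :: "nat \<Rightarrow> real \<Rightarrow> real" where
  "legendre 0 x = 1"
| "legendre (Suc 0) x = x"
| "legendre (Suc (Suc n)) x =
     ((2 * real n + 3) * x * legendre (Suc n) x - (real n + 1) * legendre n x) / (real n + 2)"

text \<open>
  The argument of \<^const>\<open>legendre\<close> is the affine coordinate along the line through the edge that is
  -1 at the starting point and 1 at the end point.
\<close>

definition ell :: "edge \<Rightarrow> nat \<Rightarrow> real^2 \<Rightarrow> real"
  where "ell E k x =
           legendre k (2 * ((x - fst E) \<bullet> (snd E - fst E)) / (norm (snd E - fst E))\<^sup>2 - 1)"

end

theory Submission
  imports Defs
begin

text \<open>
  Let \<open>u\<close> and \<open>w\<close> be the edge vectors of the parallelogram, \<open>\<xi>\<close> and \<open>\<eta>\<close> the affine coordinates of the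
  frame \<open>(a; u, w)\<close>, and write a symmetric tensor field as
  \<open>M = A u u\<^sup>T + B (u w\<^sup>T + w u\<^sup>T) + C w w\<^sup>T\<close>. Multiplying out the symmetrized products of \<open>Q\<^sup>0\<close> and
  \<open>RT\<^sup>1\<close> fields shows that the triples \<open>(A, B, C)\<close> that occur form a space of
  polynomials in \<open>\<xi>, \<eta>\<close> with 20 coefficients: five monomials for \<open>A\<close>, five for \<open>C\<close>, six for \<open>B\<close>, and
  four further terms, each of which ties a cubic monomial of \<open>A\<close> or \<open>C\<close> to one of \<open>B\<close>
  (\<open>X_par_eq_range_shape_field\<close>). There are also 20 degrees of freedom, and they depend linearly on the
  coefficients. Hence it is enough to show that a field with vanishing degrees of freedom is zero
  (\<open>functionals_unisolvent\<close>).

  The advantage of the frame \<open>u, w\<close> is that the traces decouple. On an edge parallel to \<open>u\<close> the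
  normal-normal trace is a multiple of \<open>C\<close>, the tangential-normal component is a multiple of \<open>B + \<kappa> C\<close>
  with \<open>\<kappa> = u \<bullet> w / u \<bullet> u\<close>, and the effective shear trace is a multiple of
  \<open>2 \<partial>\<^sub>\<xi> B + \<partial>\<^sub>\<eta> C + \<kappa> \<partial>\<^sub>\<xi> C\<close> (\<open>tr_n_parallel\<close>, \<open>tMn_parallel\<close>, \<open>tr_t_parallel\<close>); exchanging the
  roles of \<open>u\<close> and \<open>w\<close> gives the other two edges. All these traces other than the tangential-normal one
  are affine along the edge (\<open>edge_affine_traces\<close>), so that their two Legendre moments vanish exactly
  if their values at both end points do (\<open>edge_moments_eq_0\<close>).

  For a field in the kernel of the degrees of freedom, \<open>A\<close> and \<open>C\<close> therefore vanish at the four vertices.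
  Then the jump at a vertex is \<open>\<plusminus> 2 B\<close> times the area of the parallelogram, so \<open>B\<close> vanishes there, too, and
  so do the two combinations of derivatives. These are 20 homogeneous linear equations for the 20
  coefficients, and elimination leaves only the zero solution (\<open>vertex_values_determine_coeffs\<close>).
\<close>

section \<open>Tensor fields in a frame and their traces on parallel edges\<close>

definition wedge :: "real^2 \<Rightarrow> real^2 \<Rightarrow> real"
  where "wedge v w = v $ 1 * w $ 2 - v $ 2 * w $ 1"

definition outer :: "real^2 \<Rightarrow> real^2 \<Rightarrow> real^2^2"
  where "outer v w = (\<chi> i j. v $ i * w $ j)"

lemma wedge_self: "wedge v v = 0"
  and wedge_swap: "wedge w v = - wedge v w"
  by (simp_all add: wedge_def)

definition sym_field ::
    "real^2 \<Rightarrow> real^2 \<Rightarrow> (real^2 \<Rightarrow> real) \<Rightarrow> (real^2 \<Rightarrow> real) \<Rightarrow> (real^2 \<Rightarrow> real) \<Rightarrow> real^2 \<Rightarrow> real^2^2"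
  where "sym_field u w A B C x =
    A x *\<^sub>R outer u u + B x *\<^sub>R (outer u w + outer w u) + C x *\<^sub>R outer w w"

text \<open>
  Facts about edges parallel to the first frame vector carry over to the second one by this symmetry.
\<close>

lemma sym_field_swap: "sym_field w u C B A = sym_field u w A B C"
  by (simp add: sym_field_def fun_eq_iff algebra_simps)

lemma dir_deriv_eq: "(f has_derivative f') (at x) \<Longrightarrow> dir_deriv f v x = f' v"
  unfolding dir_deriv_def by (metis frechet_derivative_at)

lemma linear_axis_sum:
  fixes f :: "real^2 \<Rightarrow> real"
  assumes "linear f"
  shows "f v = v $ 1 * f (axis 1 1) + v $ 2 * f (axis 2 1)"
proof -
  have "v = v $ 1 *\<^sub>R axis 1 1 + v $ 2 *\<^sub>R axis 2 1"
    by (simp add: vec_eq_iff forall_2 axis_def)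
  then have "f v = f (v $ 1 *\<^sub>R axis 1 1 + v $ 2 *\<^sub>R axis 2 1)" by simp
  then show ?thesis using assms by (simp add: linear_add linear_scale)
qed

text \<open>
  Differentiating \<open>A u u\<^sup>T\<close> row by row produces only the directional derivative of \<open>A\<close> along the right
  factor \<open>u\<close>, and likewise for the other terms. This is why only derivatives along the frame vectors
  occur.
\<close>

lemma Div_sym_field:
  assumes A: "(A has_derivative A') (at x)" and B: "(B has_derivative B') (at x)"
    and C: "(C has_derivative C') (at x)"
  shows "Div (sym_field u w A B C) x = (A' u + B' w) *\<^sub>R u + (B' u + C' w) *\<^sub>R w"
proof -
  have lin: "linear A'" "linear B'" "linear C'"
    using A B C by (auto dest: has_derivative_linear)
  have entry: "dir_deriv (\<lambda>y. sym_field u w A B C y $ i $ j) v x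
      = A' v * (u $ i * u $ j) + B' v * (u $ i * w $ j + w $ i * u $ j) + C' v * (w $ i * w $ j)"
    for i j v
    by (rule dir_deriv_eq)
      (auto simp: sym_field_def outer_def intro!: derivative_eq_intros A B C)
  show ?thesis
    unfolding Div_def entry
    by (simp add: vec_eq_iff sum_2 linear_axis_sum[OF lin(1), of u] linear_axis_sum[OF lin(2), of u]
        linear_axis_sum[OF lin(2), of w] linear_axis_sum[OF lin(3), of w] algebra_simps)
qed

lemma normal_inner: "normal E \<bullet> v = wedge v (snd E - fst E) / norm (snd E - fst E)"
  by (simp add: normal_def tangent_def inner_vec_def sum_2 wedge_def divide_simps)

lemma inner_outer_mult: "x \<bullet> (outer v w *v y) = (x \<bullet> v) * (w \<bullet> y)"
  by (simp add: outer_def matrix_vector_mult_def inner_vec_def sum_2 algebra_simps)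

lemma inner_sym_field_mult:
  "p \<bullet> (sym_field u w A B C x *v q) = A x * ((p \<bullet> u) * (q \<bullet> u))
     + B x * ((p \<bullet> u) * (q \<bullet> w) + (p \<bullet> w) * (q \<bullet> u)) + C x * ((p \<bullet> w) * (q \<bullet> w))"
  unfolding sym_field_def
  by (simp add: matrix_vector_mult_add_rdistrib scaleR_matrix_vector_assoc[symmetric] inner_add_right
      inner_outer_mult inner_commute[of _ q])

text \<open>
  An edge parallel to \<open>u\<close> has a normal vector orthogonal to \<open>u\<close>, and this removes all terms with a factor
  \<open>n \<bullet> u\<close>. The orientation \<open>\<sigma>\<close> enters \<open>t\<close> and \<open>n\<close> alike: it drops out of the normal-normal and the
  tangential-normal components and survives in the divergence and in the tangential derivative.
\<close>

lemma
  assumes e: "snd E - fst E = \<sigma> *\<^sub>R u" and \<sigma>: "\<bar>\<sigma>\<bar> = 1" and u: "u \<noteq> 0"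
  shows tr_n_parallel: "tr_n E (sym_field u w A B C) x = (wedge u w / norm u)\<^sup>2 * C x"
    and tMn_parallel: "tMn E (sym_field u w A B C) x
        = - wedge u w * (B x + (u \<bullet> w) / (u \<bullet> u) * C x)"
    and tr_t_parallel:
      "\<lbrakk>(A has_derivative A') (at x); (B has_derivative B') (at x); (C has_derivative C') (at x)\<rbrakk>
       \<Longrightarrow> tr_t E (sym_field u w A B C) x = - \<sigma> * (wedge u w / norm u)
          * (2 * B' u + C' w + (u \<bullet> w) / (u \<bullet> u) * C' u)"
proof -
  have ne: "norm (snd E - fst E) = norm u"
    using \<sigma> by (simp add: e)
  have \<sigma>': "\<sigma> = 1 \<or> \<sigma> = - 1"
    using \<sigma> by linarith
  have nu: "normal E \<bullet> u = 0" and nw: "normal E \<bullet> w = - \<sigma> * wedge u w / norm u"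
    by (simp_all add: normal_inner ne) (simp_all add: e wedge_def algebra_simps diff_divide_distrib)
  have t: "tangent E = (\<sigma> / norm u) *\<^sub>R u"
    by (simp add: tangent_def ne \<sigma>) (simp add: e divide_inverse mult.commute)
  have uu: "u \<bullet> u = norm u * norm u" by (simp add: power2_norm_eq_inner[symmetric] power2_eq_square)
  show "tr_n E (sym_field u w A B C) x = (wedge u w / norm u)\<^sup>2 * C x"
    using \<sigma>' by (auto simp: tr_n_def inner_sym_field_mult nu nw power2_eq_square)
  have tM: "tMn E (sym_field u w A B C) y = - wedge u w * (B y + (u \<bullet> w) / (u \<bullet> u) * C y)" for y
    using \<sigma>' u by (auto simp: tMn_def inner_sym_field_mult nu nw t uu field_simps)
  then show "tMn E (sym_field u w A B C) x = - wedge u w * (B x + (u \<bullet> w) / (u \<bullet> u) * C x)" .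
  assume A: "(A has_derivative A') (at x)" and B: "(B has_derivative B') (at x)"
    and C: "(C has_derivative C') (at x)"
  have dd: "dir_deriv (tMn E (sym_field u w A B C)) v x
      = - wedge u w * (B' v + (u \<bullet> w) / (u \<bullet> u) * C' v)" for v
    unfolding tM[abs_def] by (rule dir_deriv_eq) (auto simp: u intro!: derivative_eq_intros B C)
  show "tr_t E (sym_field u w A B C) x = - \<sigma> * (wedge u w / norm u)
          * (2 * B' u + C' w + (u \<bullet> w) / (u \<bullet> u) * C' u)"
    unfolding tr_t_def Div_sym_field[OF A B C] dd t
    using linear_scale[OF has_derivative_linear[OF B]] linear_scale[OF has_derivative_linear[OF C]]
    by (simp add: inner_add_right nu nw algebra_simps add_divide_distrib)
qed

lemma ell_edge_point:
  assumes "fst E \<noteq> snd E"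
  shows "ell E 0 (edge_point E s) = 1" "ell E (Suc 0) (edge_point E s) = 2 * s - 1"
proof -
  have "(edge_point E s - fst E) \<bullet> (snd E - fst E) / (norm (snd E - fst E))\<^sup>2 = s"
    using assms by (simp add: edge_point_def power2_norm_eq_inner)
  then show "ell E 0 (edge_point E s) = 1" "ell E (Suc 0) (edge_point E s) = 2 * s - 1"
    by (simp_all add: ell_def)
qed

definition edge_affine :: "edge \<Rightarrow> (real^2 \<Rightarrow> real) \<Rightarrow> bool"
  where "edge_affine E f \<longleftrightarrow>
    (\<forall>s. f (edge_point E s) = (1 - s) * f (fst E) + s * f (snd E))"

text \<open>
  An affine function on an edge is determined by its two end values, and its first two Legendre moments
  are, up to positive factors, the sum and the difference of these values.
\<close>

lemma edge_moments:
  assumes E: "fst E \<noteq> snd E" and f: "edge_affine E f"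
  shows "edge_inner E f (ell E 0) = norm (snd E - fst E) * ((f (fst E) + f (snd E)) / 2)"
    and "edge_inner E f (ell E (Suc 0)) = norm (snd E - fst E) * ((f (snd E) - f (fst E)) / 6)"
proof -
  define p q where "p = f (fst E)" and "q = f (snd E)"
  have fE: "f (edge_point E s) = (1 - s) * p + s * q" for s
    using f by (simp add: edge_affine_def p_def q_def)
  have "((\<lambda>s. ((1 - s) * p + s * q) * 1) has_integral
      (p * 1 + (q - p) * 1\<^sup>2 / 2) - (p * 0 + (q - p) * 0\<^sup>2 / 2)) {0..1::real}"
    by (rule fundamental_theorem_of_calculus)
      (auto intro!: derivative_eq_intros simp flip: has_real_derivative_iff_has_vector_derivative
        simp: field_simps)
  note int = integral_unique[OF this]
  show "edge_inner E f (ell E 0) = norm (snd E - fst E) * ((f (fst E) + f (snd E)) / 2)"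
    unfolding edge_inner_def ell_edge_point[OF E] fE int by (simp add: p_def q_def field_simps)
  have "((\<lambda>s. ((1 - s) * p + s * q) * (2 * s - 1)) has_integral
      (- p * 1 + (3 * p - q) * 1\<^sup>2 / 2 + 2 * (q - p) * 1 ^ 3 / 3)
      - (- p * 0 + (3 * p - q) * 0\<^sup>2 / 2 + 2 * (q - p) * 0 ^ 3 / 3)) {0..1::real}"
    by (rule fundamental_theorem_of_calculus)
      (auto intro!: derivative_eq_intros simp flip: has_real_derivative_iff_has_vector_derivative
        simp: algebra_simps power2_eq_square add_divide_distrib diff_divide_distrib)
  note int = integral_unique[OF this]
  show "edge_inner E f (ell E (Suc 0)) = norm (snd E - fst E) * ((f (snd E) - f (fst E)) / 6)"
    unfolding edge_inner_def ell_edge_point[OF E] fE int by (simp add: p_def q_def field_simps)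
qed

lemma edge_moments_eq_0:
  assumes E: "fst E \<noteq> snd E" and f: "edge_affine E f"
    and 0: "\<forall>k\<in>{0, 1}. edge_inner E f (ell E k) = 0"
  shows "f (fst E) = 0" "f (snd E) = 0"
  using 0 E by (auto simp: edge_moments[OF E f])

lemma edge_norm_ell_pos:
  assumes E: "fst E \<noteq> snd E" and "k \<in> {0, 1}"
  shows "edge_norm E (ell E k) > 0"
proof -
  have ends: "edge_point E 0 = fst E" "edge_point E 1 = snd E"
    by (simp_all add: edge_point_def)
  have vals: "ell E 0 (fst E) = 1" "ell E 0 (snd E) = 1"
      "ell E (Suc 0) (fst E) = - 1" "ell E (Suc 0) (snd E) = 1"
    unfolding ends[symmetric] by (simp_all add: ell_edge_point[OF E])
  have "edge_affine E (ell E 0)" "edge_affine E (ell E (Suc 0))"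
    unfolding edge_affine_def vals by (simp_all add: ell_edge_point[OF E])
  note edge_moments(1)[OF E this(1)] edge_moments(2)[OF E this(2)]
  moreover have "norm (snd E - fst E) > 0"
    using E by simp
  ultimately have "edge_inner E (ell E 0) (ell E 0) > 0"
    "edge_inner E (ell E (Suc 0)) (ell E (Suc 0)) > 0"
    by (simp_all only: vals) simp_all
  then show ?thesis
    using assms(2) by (auto simp: edge_norm_def)
qed

text \<open>
  Finitely many linear functionals on a Euclidean space, at most as many as its dimension, whose common
  kernel is trivial form a basis of the dual space. To remain within one space, the values of the
  functionals are used as coordinates with respect to distinct basis vectors; the resulting
  endomorphism is injective and hence surjective.
\<close>

lemma functionals_unisolvent:
  fixes T :: "'a::euclidean_space \<Rightarrow> 'i \<Rightarrow> real"
  assumes I: "finite I" "card I \<le> DIM('a)"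
    and lin: "\<And>i. i \<in> I \<Longrightarrow> linear (\<lambda>p. T p i)"
    and ker: "\<And>p. (\<And>i. i \<in> I \<Longrightarrow> T p i = 0) \<Longrightarrow> p = 0"
  shows "\<exists>!p. \<forall>i\<in>I. T p i = v i"
proof -
  obtain b :: "'i \<Rightarrow> 'a" where b: "b ` I \<subseteq> Basis" "inj_on b I"
    using card_le_inj[OF I(1) finite_Basis I(2)] by blast
  define g where "g c = (\<Sum>i\<in>I. c i *\<^sub>R b i)" for c
  have gb: "g c \<bullet> b i = c i" if "i \<in> I" for c i
  proof -
    have "g c \<bullet> b i = (\<Sum>j\<in>I. if j = i then c j else 0)"
      unfolding g_def inner_sum_left using b that
      by (intro sum.cong) (auto simp: inner_Basis inj_on_eq_iff image_subset_iff)
    with that I(1) show ?thesis by simp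
  qed
  have "linear (\<lambda>p. g (T p))"
    unfolding g_def
  proof (intro linear_compose_sum ballI linearI)
    fix i assume "i \<in> I"
    note lin[OF this]
    from linear_add[OF this] linear_scale[OF this]
    show "T (p + q) i *\<^sub>R b i = T p i *\<^sub>R b i + T q i *\<^sub>R b i"
      and "T (r *\<^sub>R p) i *\<^sub>R b i = r *\<^sub>R T p i *\<^sub>R b i" for p q r
      by (simp_all add: scaleR_add_left)
  qed
  note lin_g = this
  have "inj (\<lambda>p. g (T p))"
    unfolding linear_injective_0[OF lin_g] by (metis gb inner_zero_left ker)
  with lin_g have "surj (\<lambda>p. g (T p))"
    by (rule linear_inj_imp_surj)
  then obtain p where "g v = g (T p)" by blast
  then have p: "\<forall>i\<in>I. T p i = v i" by (metis gb)
  moreover have "q = p" if "\<forall>i\<in>I. T q i = v i" for q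
  proof -
    have "T (q - p) i = 0" if "i \<in> I" for i
      using linear_diff[OF lin[OF that], of q p] p \<open>\<forall>i\<in>I. T q i = v i\<close> that by simp
    then show ?thesis using ker[of "q - p"] by simp
  qed
  ultimately show ?thesis by blast
qed

text \<open>
  The 20 coefficients of a field: five for monomials in the \<open>u u\<^sup>T\<close> component, five in the \<open>w w\<^sup>T\<close>
  component, six in the mixed component, and four common to two components. The common ones come from
  the part \<open>x P\<^sub>h\<^sub>o\<^sub>m\<close> of the Raviart-Thomas space, whose cubic products contribute to a diagonal
  component and, with half the weight, to the mixed component. Tuples of real numbers form a
  Euclidean space, which allows for the dimension count.
\<close>

type_synonym coeffs =
  "(real \<times> real \<times> real \<times> real \<times> real) \<times> (real \<times> real \<times> real \<times> real \<times> real) \<times>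
   (real \<times> real \<times> real \<times> real \<times> real \<times> real) \<times> (real \<times> real \<times> real \<times> real)"

fun coef_uu :: "coeffs \<Rightarrow> real \<Rightarrow> real \<Rightarrow> real" where
  "coef_uu ((a1, a2, a3, a4, a5), c, b, (m1, m2, m3, m4)) \<xi> \<eta> =
     a1 + a2 * \<xi> + a3 * \<eta> + a4 * \<xi>\<^sup>2 + a5 * (\<xi> * \<eta>) + m1 * \<xi> ^ 3 + m2 * (\<xi>\<^sup>2 * \<eta>)"

fun coef_ww :: "coeffs \<Rightarrow> real \<Rightarrow> real \<Rightarrow> real" where
  "coef_ww (a, (c1, c2, c3, c4, c5), b, (m1, m2, m3, m4)) \<xi> \<eta> =
     c1 + c2 * \<eta> + c3 * \<xi> + c4 * \<eta>\<^sup>2 + c5 * (\<xi> * \<eta>) + m3 * \<eta> ^ 3 + m4 * (\<xi> * \<eta>\<^sup>2)"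

fun coef_uw :: "coeffs \<Rightarrow> real \<Rightarrow> real \<Rightarrow> real" where
  "coef_uw (a, c, (b1, b2, b3, b4, b5, b6), (m1, m2, m3, m4)) \<xi> \<eta> =
     b1 + b2 * \<xi> + b3 * \<eta> + b4 * \<xi>\<^sup>2 + b5 * (\<xi> * \<eta>) + b6 * \<eta>\<^sup>2
     + (m1 + m4) / 2 * (\<xi>\<^sup>2 * \<eta>) + (m2 + m3) / 2 * (\<xi> * \<eta>\<^sup>2)"

text \<open>
  The partial derivatives with respect to \<open>\<xi>\<close> and \<open>\<eta>\<close>, as \<open>has_derivative_coeffs\<close> confirms.
\<close>

fun coef_uu_xi :: "coeffs \<Rightarrow> real \<Rightarrow> real \<Rightarrow> real" where
  "coef_uu_xi ((a1, a2, a3, a4, a5), c, b, (m1, m2, m3, m4)) \<xi> \<eta> =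
     a2 + 2 * a4 * \<xi> + a5 * \<eta> + 3 * m1 * \<xi>\<^sup>2 + 2 * m2 * (\<xi> * \<eta>)"
fun coef_uu_eta :: "coeffs \<Rightarrow> real \<Rightarrow> real \<Rightarrow> real" where
  "coef_uu_eta ((a1, a2, a3, a4, a5), c, b, (m1, m2, m3, m4)) \<xi> \<eta> = a3 + a5 * \<xi> + m2 * \<xi>\<^sup>2"
fun coef_ww_xi :: "coeffs \<Rightarrow> real \<Rightarrow> real \<Rightarrow> real" where
  "coef_ww_xi (a, (c1, c2, c3, c4, c5), b, (m1, m2, m3, m4)) \<xi> \<eta> = c3 + c5 * \<eta> + m4 * \<eta>\<^sup>2"
fun coef_ww_eta :: "coeffs \<Rightarrow> real \<Rightarrow> real \<Rightarrow> real" where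
  "coef_ww_eta (a, (c1, c2, c3, c4, c5), b, (m1, m2, m3, m4)) \<xi> \<eta> =
     c2 + 2 * c4 * \<eta> + c5 * \<xi> + 3 * m3 * \<eta>\<^sup>2 + 2 * m4 * (\<xi> * \<eta>)"
fun coef_uw_xi :: "coeffs \<Rightarrow> real \<Rightarrow> real \<Rightarrow> real" where
  "coef_uw_xi (a, c, (b1, b2, b3, b4, b5, b6), (m1, m2, m3, m4)) \<xi> \<eta> =
     b2 + 2 * b4 * \<xi> + b5 * \<eta> + (m1 + m4) * (\<xi> * \<eta>) + (m2 + m3) / 2 * \<eta>\<^sup>2"
fun coef_uw_eta :: "coeffs \<Rightarrow> real \<Rightarrow> real \<Rightarrow> real" where
  "coef_uw_eta (a, c, (b1, b2, b3, b4, b5, b6), (m1, m2, m3, m4)) \<xi> \<eta> =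
     b3 + b5 * \<xi> + 2 * b6 * \<eta> + (m1 + m4) / 2 * \<xi>\<^sup>2 + (m2 + m3) * (\<xi> * \<eta>)"

lemma linear_coeffs:
  "linear (\<lambda>p. coef_uu p \<xi> \<eta>)" "linear (\<lambda>p. coef_uw p \<xi> \<eta>)" "linear (\<lambda>p. coef_ww p \<xi> \<eta>)"
  "linear (\<lambda>p. coef_uu_xi p \<xi> \<eta>)" "linear (\<lambda>p. coef_uw_xi p \<xi> \<eta>)" "linear (\<lambda>p. coef_ww_xi p \<xi> \<eta>)"
  "linear (\<lambda>p. coef_uu_eta p \<xi> \<eta>)" "linear (\<lambda>p. coef_uw_eta p \<xi> \<eta>)" "linear (\<lambda>p. coef_ww_eta p \<xi> \<eta>)"
  by (rule linearI; auto simp: algebra_simps add_divide_distrib)+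

lemma has_derivative_coeffs:
  assumes X: "(X has_derivative X') (at x)" and Y: "(Y has_derivative Y') (at x)"
  shows "((\<lambda>y. coef_uu p (X y) (Y y)) has_derivative
            (\<lambda>v. coef_uu_xi p (X x) (Y x) * X' v + coef_uu_eta p (X x) (Y x) * Y' v)) (at x)"
    and "((\<lambda>y. coef_uw p (X y) (Y y)) has_derivative
            (\<lambda>v. coef_uw_xi p (X x) (Y x) * X' v + coef_uw_eta p (X x) (Y x) * Y' v)) (at x)"
    and "((\<lambda>y. coef_ww p (X y) (Y y)) has_derivative
            (\<lambda>v. coef_ww_xi p (X x) (Y x) * X' v + coef_ww_eta p (X x) (Y x) * Y' v)) (at x)"
proof -
  obtain a1 a2 a3 a4 a5 c1 c2 c3 c4 c5 b1 b2 b3 b4 b5 b6 m1 m2 m3 m4 where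
    p: "p = ((a1, a2, a3, a4, a5), (c1, c2, c3, c4, c5), (b1, b2, b3, b4, b5, b6), (m1, m2, m3, m4))"
    by (metis surj_pair)
  \<comment> \<open>Naming the halves keeps the simplifier from multiplying out the denominators.\<close>
  define k n where "k = (m1 + m4) / 2" and "n = (m2 + m3) / 2"
  have kn: "m1 + m4 = 2 * k" "m2 + m3 = 2 * n" "2 * k / 2 = k" "2 * n / 2 = n"
    by (simp_all add: k_def n_def)
  show "((\<lambda>y. coef_uu p (X y) (Y y)) has_derivative
            (\<lambda>v. coef_uu_xi p (X x) (Y x) * X' v + coef_uu_eta p (X x) (Y x) * Y' v)) (at x)"
    and "((\<lambda>y. coef_uw p (X y) (Y y)) has_derivative
            (\<lambda>v. coef_uw_xi p (X x) (Y x) * X' v + coef_uw_eta p (X x) (Y x) * Y' v)) (at x)"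
    and "((\<lambda>y. coef_ww p (X y) (Y y)) has_derivative
            (\<lambda>v. coef_ww_xi p (X x) (Y x) * X' v + coef_ww_eta p (X x) (Y x) * Y' v)) (at x)"
    unfolding p coef_uu.simps coef_uw.simps coef_ww.simps coef_uu_xi.simps coef_uw_xi.simps
      coef_ww_xi.simps coef_uu_eta.simps coef_uw_eta.simps coef_ww_eta.simps kn
    by (auto intro!: derivative_eq_intros X Y simp: fun_eq_iff algebra_simps power2_eq_square)
qed

text \<open>
  The core of the proof: five quantities at four vertices determine the 20 coefficients. The vertex
  values of the diagonal components force these to have the form \<open>\<xi> (1 - \<xi>)\<close> or \<open>\<eta> (1 - \<eta>)\<close> times an
  affine function. Then the derivatives of the diagonal components along the edges drop out, and with
  them the skewness parameters \<open>\<kappa>\<close> and \<open>\<mu>\<close>: the equations are the same as for a rectangle. The remaining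
  ones express all coefficients by the two coefficients \<open>b2\<close> and \<open>b3\<close> of the mixed component, for which
  \<open>8 * b2 = 0\<close> and \<open>8 * b3 = 0\<close> are left.
\<close>

lemma vertex_values_determine_coeffs:
  assumes v: "\<And>\<xi> \<eta>. \<lbrakk>\<xi> \<in> {0, 1}; \<eta> \<in> {0, 1}\<rbrakk> \<Longrightarrow> coef_uu p \<xi> \<eta> = 0 \<and> coef_uw p \<xi> \<eta> = 0 \<and> coef_ww p \<xi> \<eta> = 0
      \<and> 2 * coef_uw_xi p \<xi> \<eta> + coef_ww_eta p \<xi> \<eta> + \<kappa> * coef_ww_xi p \<xi> \<eta> = 0
      \<and> 2 * coef_uw_eta p \<xi> \<eta> + coef_uu_xi p \<xi> \<eta> + \<mu> * coef_uu_eta p \<xi> \<eta> = 0"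
  shows "p = 0"
proof -
  obtain a1 a2 a3 a4 a5 c1 c2 c3 c4 c5 b1 b2 b3 b4 b5 b6 m1 m2 m3 m4 where
    p: "p = ((a1, a2, a3, a4, a5), (c1, c2, c3, c4, c5), (b1, b2, b3, b4, b5, b6), (m1, m2, m3, m4))"
    by (metis surj_pair)
  have A: "a1 = 0" "a3 = 0" "a4 = - a2 - m1" "a5 = - m2"
    using v[of 0 0] v[of 0 1] v[of 1 0] v[of 1 1] by (simp_all add: p)
  have C: "c1 = 0" "c3 = 0" "c4 = - c2 - m3" "c5 = - m4"
    using v[of 0 0] v[of 0 1] v[of 1 0] v[of 1 1] by (simp_all add: p)
  have B: "b1 = 0" "b4 = - b2" "b6 = - b3" "b5 = - (m1 + m2 + m3 + m4) / 2"
    using v[of 0 0] v[of 0 1] v[of 1 0] v[of 1 1] by (simp_all add: p field_simps)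
  have G: "2 * b2 + c2 = 0" "m4 = - 4 * b2" "2 * b3 + a2 = 0" "m2 = - 4 * b3"
    "2 * b2 + 2 * b5 + m2 + m3 + c2 + 2 * c4 + 3 * m3 = 0"
    "2 * b3 + 2 * b5 + m1 + m4 + a2 + 2 * a4 + 3 * m1 = 0"
    "m1 = 8 * b2" "m3 = 8 * b3"
    using v[of 0 0] v[of 0 1] v[of 1 0] v[of 1 1] by (simp_all add: p A B C field_simps)
  show ?thesis
    using A B C G by (simp add: p zero_prod_def)
qed

locale frame =
  fixes a u w :: "real^2"
  assumes wedge_pos: "wedge u w > 0"
begin

definition coord_u :: "real^2 \<Rightarrow> real"
  where "coord_u v = wedge v w / wedge u w"

definition coord_w :: "real^2 \<Rightarrow> real"
  where "coord_w v = wedge u v / wedge u w"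

lemma linear_coord: "linear coord_u" "linear coord_w"
  by (rule linearI; simp add: coord_u_def coord_w_def wedge_def algebra_simps add_divide_distrib
      diff_divide_distrib)+

lemma coord_frame [simp]: "coord_u u = 1" "coord_u w = 0" "coord_w u = 0" "coord_w w = 1"
  using wedge_pos by (simp_all add: coord_u_def coord_w_def wedge_self)

lemma frame_expansion: "v = coord_u v *\<^sub>R u + coord_w v *\<^sub>R w"
proof -
  have "wedge u w *\<^sub>R v = wedge v w *\<^sub>R u + wedge u v *\<^sub>R w"
    by (simp add: vec_eq_iff forall_2 wedge_def algebra_simps)
  then have "v = (1 / wedge u w) *\<^sub>R (wedge v w *\<^sub>R u + wedge u v *\<^sub>R w)"
    using wedge_pos by (metis scaleR_scaleR divide_self_if less_irrefl mult_1 scaleR_one times_divide_eq_left)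
  then show ?thesis
    by (simp add: coord_u_def coord_w_def scaleR_add_right)
qed

lemma frame_nonzero: "u \<noteq> 0" "w \<noteq> 0" "u + w \<noteq> 0" "u - w \<noteq> 0"
  using wedge_pos linear_add[OF linear_coord(1), of u w] linear_diff[OF linear_coord(1), of u w]
  by (auto simp: linear_0[OF linear_coord(1)]) (auto simp: wedge_def)

definition xi :: "real^2 \<Rightarrow> real" where "xi x = coord_u (x - a)"
definition eta :: "real^2 \<Rightarrow> real" where "eta x = coord_w (x - a)"

lemma xi_eta_frame:
  "xi (a + r *\<^sub>R u + t *\<^sub>R w) = r" "eta (a + r *\<^sub>R u + t *\<^sub>R w) = t"
  by (simp_all add: xi_def eta_def add.assoc linear_coord linear_add linear_scale)

lemma point_expansion: "x = a + xi x *\<^sub>R u + eta x *\<^sub>R w"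
  using frame_expansion[of "x - a"] by (simp add: xi_def eta_def algebra_simps)

lemma has_derivative_xi_eta:
  "(xi has_derivative coord_u) (at x)" "(eta has_derivative coord_w) (at x)"
  unfolding xi_def[abs_def] eta_def[abs_def]
  by (auto intro!: derivative_eq_intros
      bounded_linear.has_derivative[OF linear_coord(1)[unfolded linear_conv_bounded_linear]]
      bounded_linear.has_derivative[OF linear_coord(2)[unfolded linear_conv_bounded_linear]])

definition shape_field :: "coeffs \<Rightarrow> real^2 \<Rightarrow> real^2^2"
  where "shape_field p = sym_field u w (\<lambda>x. coef_uu p (xi x) (eta x)) (\<lambda>x. coef_uw p (xi x) (eta x))
    (\<lambda>x. coef_ww p (xi x) (eta x))"

lemma linear_shape_field: "linear shape_field"
  by (rule linearI)
    (simp_all add: shape_field_def sym_field_def fun_eq_iff scaleR_fun_def linear_coeffs[THEN linear_add]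
      linear_coeffs[THEN linear_scale] algebra_simps)

end

section \<open>The local space in frame coordinates\<close>

lemma span_2_iff: "v \<in> span {b, c} \<longleftrightarrow> (\<exists>k l. v = k *\<^sub>R b + l *\<^sub>R c)"
  and span_3_iff: "v \<in> span {b, c, e} \<longleftrightarrow> (\<exists>k l m. v = k *\<^sub>R b + l *\<^sub>R c + m *\<^sub>R e)"
  for v :: "'v::real_vector"
proof -
  have "v - k *\<^sub>R b - l *\<^sub>R c = 0 \<longleftrightarrow> v = k *\<^sub>R b + l *\<^sub>R c"
    and "v - k *\<^sub>R b - l *\<^sub>R c - m *\<^sub>R e = 0 \<longleftrightarrow> v = k *\<^sub>R b + l *\<^sub>R c + m *\<^sub>R e" for k l m
    by (auto simp: algebra_simps)
  then show "v \<in> span {b, c} \<longleftrightarrow> (\<exists>k l. v = k *\<^sub>R b + l *\<^sub>R c)"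
    "v \<in> span {b, c, e} \<longleftrightarrow> (\<exists>k l m. v = k *\<^sub>R b + l *\<^sub>R c + m *\<^sub>R e)"
    by (simp_all add: span_breakdown_eq)
qed

text \<open>
  Images of sets of exponents can be computed by simplification once these sets are enumerated.
\<close>

lemma Pol_as_span_image: "Pol p = span ((\<lambda>(i, j) x. (x $ 1) ^ i * (x $ 2) ^ j) ` {(i, j). i + j \<le> p})"
  and Pol_hom_as_span_image:
    "Pol_hom p = span ((\<lambda>(i, j) x. (x $ 1) ^ i * (x $ 2) ^ j) ` {(i, j). i + j = p})"
  unfolding Pol_def Pol_hom_def by (rule arg_cong[where f = span]; force)+

lemma Pol_0_iff: "f \<in> Pol 0 \<longleftrightarrow> (\<exists>k. f = (\<lambda>x. k))"
proof -
  have "{(i::nat, j). i + j \<le> 0} = {(0, 0)}"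
    by auto
  then have "Pol 0 = span {\<lambda>x. 1}"
    by (simp add: Pol_as_span_image)
  then show ?thesis
    by (auto simp: span_singleton scaleR_fun_def)
qed

lemma Pol_1_iff: "f \<in> Pol 1 \<longleftrightarrow> (\<exists>k k1 k2. f = (\<lambda>x. k + k1 * x $ 1 + k2 * x $ 2))"
proof -
  have "{(i::nat, j). i + j \<le> 1} = {(0, 0), (1, 0), (0, 1)}"
    by auto
  then have "Pol 1 = span {\<lambda>x. 1, \<lambda>x. x $ 1, \<lambda>x. x $ 2}"
    by (simp add: Pol_as_span_image)
  then show ?thesis
    by (simp add: span_3_iff scaleR_fun_def plus_fun_def)
qed

lemma Pol_hom_1_iff: "f \<in> Pol_hom 1 \<longleftrightarrow> (\<exists>k1 k2. f = (\<lambda>x. k1 * x $ 1 + k2 * x $ 2))"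
proof -
  have "{(i::nat, j). i + j = 1} = {(1, 0), (0, 1)}"
    by auto
  then have "Pol_hom 1 = span {\<lambda>x. x $ 1, \<lambda>x. x $ 2}"
    by (simp add: Pol_hom_as_span_image)
  then show ?thesis
    by (simp add: span_2_iff scaleR_fun_def plus_fun_def)
qed

lemma Q0_ref_iff:
  "\<phi> \<in> Q0_ref \<longleftrightarrow> (\<exists>k1 k2 k3 k4. \<phi> = (\<lambda>x. vector [k1 + k2 * x $ 1, k3 + k4 * x $ 2]))"
proof -
  have q: "q \<in> Pol_vec 0 \<longleftrightarrow> (\<exists>k1 k3. q = (\<lambda>x. vector [k1, k3]))" for q
    by (simp add: Pol_vec_def Pol_0_iff forall_2 fun_eq_iff vec_eq_iff) metis
  have r: "r \<in> span {(\<lambda>x. vector [x $ 1, 0]), (\<lambda>x. vector [0, x $ 2])}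
      \<longleftrightarrow> (\<exists>k2 k4. r = (\<lambda>x::real^2. vector [k2 * x $ 1, k4 * x $ 2]))" for r :: "real^2 \<Rightarrow> real^2"
    by (simp add: span_2_iff fun_eq_iff scaleR_fun_def vec_eq_iff forall_2)
  have add: "(\<lambda>x. vector [k1, k3] + vector [k2 * x $ 1, k4 * x $ 2])
      = (\<lambda>x::real^2. vector [k1 + k2 * x $ 1, k3 + k4 * x $ 2] :: real^2)" for k1 k2 k3 k4
    by (simp add: fun_eq_iff vec_eq_iff forall_2)
  show ?thesis
  proof
    assume "\<phi> \<in> Q0_ref"
    then obtain k1 k2 k3 k4 where "\<phi> = (\<lambda>x. vector [k1, k3] + vector [k2 * x $ 1, k4 * x $ 2])"
      unfolding Q0_ref_def mem_Collect_eq q r by blast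
    then show "\<exists>k1 k2 k3 k4. \<phi> = (\<lambda>x. vector [k1 + k2 * x $ 1, k3 + k4 * x $ 2])"
      unfolding add by blast
  next
    assume "\<exists>k1 k2 k3 k4. \<phi> = (\<lambda>x. vector [k1 + k2 * x $ 1, k3 + k4 * x $ 2])"
    then obtain k1 k2 k3 k4 where "\<phi> = (\<lambda>x. vector [k1 + k2 * x $ 1, k3 + k4 * x $ 2])"
      by blast
    moreover define q0 r0 :: "real^2 \<Rightarrow> real^2"
      where "q0 = (\<lambda>x. vector [k1, k3])" and "r0 = (\<lambda>x. vector [k2 * x $ 1, k4 * x $ 2])"
    ultimately have "\<phi> = (\<lambda>x. q0 x + r0 x)"
      by (simp add: add)
    moreover have "q0 \<in> Pol_vec 0"
      unfolding q q0_def by blast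
    moreover have "r0 \<in> span {(\<lambda>x. vector [x $ 1, 0]), (\<lambda>x. vector [0, x $ 2])}"
      unfolding r r0_def by blast
    ultimately show "\<phi> \<in> Q0_ref"
      unfolding Q0_ref_def by blast
  qed
qed

context frame
begin

text \<open>
  Affine functions in Cartesian coordinates are affine in the frame coordinates and vice versa.
\<close>

lemma affine_iff:
  "f \<in> Pol 1 \<longleftrightarrow> (\<exists>k k1 k2. f = (\<lambda>x. k + k1 * xi x + k2 * eta x))"
proof
  assume "f \<in> Pol 1"
  then obtain k k1 k2 where f: "f = (\<lambda>x. k + k1 * x $ 1 + k2 * x $ 2)"
    unfolding Pol_1_iff by blast
  have "f x = (k + k1 * a $ 1 + k2 * a $ 2) + (k1 * u $ 1 + k2 * u $ 2) * xi x
      + (k1 * w $ 1 + k2 * w $ 2) * eta x" for x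
    unfolding f by (subst (1 2) point_expansion) (simp add: algebra_simps)
  then show "\<exists>k k1 k2. f = (\<lambda>x. k + k1 * xi x + k2 * eta x)" by blast
next
  assume "\<exists>k k1 k2. f = (\<lambda>x. k + k1 * xi x + k2 * eta x)"
  then obtain k k1 k2 where f: "f = (\<lambda>x. k + k1 * xi x + k2 * eta x)"
    by blast
  have "f x = (k - k1 * coord_u a - k2 * coord_w a) + (k1 * coord_u (axis 1 1) + k2 * coord_w (axis 1 1)) * x $ 1
      + (k1 * coord_u (axis 2 1) + k2 * coord_w (axis 2 1)) * x $ 2" for x
    unfolding f xi_def eta_def
    by (simp add: linear_diff[OF linear_coord(1)] linear_diff[OF linear_coord(2)]
      linear_axis_sum[OF linear_coord(1), of x] linear_axis_sum[OF linear_coord(2), of x] algebra_simps)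
  then show "f \<in> Pol 1" unfolding Pol_1_iff by blast
qed

text \<open>
  The Piola transformation maps the Cartesian unit vectors to multiples of \<open>u\<close> and \<open>w\<close>, and the constant
  Jacobian can be absorbed into the coefficients.
\<close>

lemma Q0_iff:
  "\<phi> \<in> Q0 a (a + u) (a + w) \<longleftrightarrow>
   (\<exists>k1 k2 k3 k4. \<phi> = (\<lambda>x. (k1 + k2 * xi x) *\<^sub>R u + (k3 + k4 * eta x) *\<^sub>R w))"
proof -
  define D where "D = wedge u w"
  have D: "D \<noteq> 0" "det (B_mat a (a + u) (a + w)) = D"
    using wedge_pos by (auto simp: D_def wedge_def B_mat_def det_2)
  have B: "B_mat a (a + u) (a + w) *v y = y $ 1 *\<^sub>R u + y $ 2 *\<^sub>R w" for y
    by (simp add: B_mat_def matrix_vector_mult_def vec_eq_iff sum_2 algebra_simps)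
  have F: "F_map a (a + u) (a + w) y = a + y $ 1 *\<^sub>R u + y $ 2 *\<^sub>R w" for y
    by (simp add: F_map_def B)
  have piola_iff: "piola a (a + u) (a + w) \<phi>h \<phi> \<longleftrightarrow>
      (\<forall>x. D *\<^sub>R \<phi> x = \<phi>h (vector [xi x, eta x]) $ 1 *\<^sub>R u + \<phi>h (vector [xi x, eta x]) $ 2 *\<^sub>R w)" for \<phi>h
  proof
    assume "piola a (a + u) (a + w) \<phi>h \<phi>"
    then have "D *\<^sub>R \<phi> (a + xi x *\<^sub>R u + eta x *\<^sub>R w)
        = \<phi>h (vector [xi x, eta x]) $ 1 *\<^sub>R u + \<phi>h (vector [xi x, eta x]) $ 2 *\<^sub>R w" for x
      unfolding piola_def D F B by (elim allE[of _ "vector [xi x, eta x]"]) simp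
    then show "\<forall>x. D *\<^sub>R \<phi> x
        = \<phi>h (vector [xi x, eta x]) $ 1 *\<^sub>R u + \<phi>h (vector [xi x, eta x]) $ 2 *\<^sub>R w"
      by (metis point_expansion)
  next
    assume *: "\<forall>x. D *\<^sub>R \<phi> x
        = \<phi>h (vector [xi x, eta x]) $ 1 *\<^sub>R u + \<phi>h (vector [xi x, eta x]) $ 2 *\<^sub>R w"
    have "vector [y $ 1, y $ 2] = y" for y :: "real^2"
      by (simp add: vec_eq_iff forall_2)
    with * show "piola a (a + u) (a + w) \<phi>h \<phi>"
      by (simp add: piola_def D F B xi_eta_frame)
  qed
  show ?thesis
  proof
    assume "\<phi> \<in> Q0 a (a + u) (a + w)"
    then obtain \<phi>h where "\<phi>h \<in> Q0_ref" and \<phi>h: "piola a (a + u) (a + w) \<phi>h \<phi>"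
      unfolding Q0_def by blast
    then obtain k1 k2 k3 k4 where "\<phi>h = (\<lambda>x. vector [k1 + k2 * x $ 1, k3 + k4 * x $ 2])"
      unfolding Q0_ref_iff by blast
    with \<phi>h have "\<And>x. D *\<^sub>R \<phi> x = (k1 + k2 * xi x) *\<^sub>R u + (k3 + k4 * eta x) *\<^sub>R w"
      by (simp add: piola_iff)
    then have "\<phi> x = (1 / D) *\<^sub>R ((k1 + k2 * xi x) *\<^sub>R u + (k3 + k4 * eta x) *\<^sub>R w)" for x
      using D(1) by (metis divide_self_if scaleR_one scaleR_scaleR times_divide_eq_left mult_1)
    then have "\<phi> = (\<lambda>x. (k1 / D + k2 / D * xi x) *\<^sub>R u + (k3 / D + k4 / D * eta x) *\<^sub>R w)"
      by (auto simp: scaleR_add_right add_divide_distrib)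
    then show "\<exists>k1 k2 k3 k4. \<phi> = (\<lambda>x. (k1 + k2 * xi x) *\<^sub>R u + (k3 + k4 * eta x) *\<^sub>R w)"
      by blast
  next
    assume "\<exists>k1 k2 k3 k4. \<phi> = (\<lambda>x. (k1 + k2 * xi x) *\<^sub>R u + (k3 + k4 * eta x) *\<^sub>R w)"
    then obtain k1 k2 k3 k4 where "\<phi> = (\<lambda>x. (k1 + k2 * xi x) *\<^sub>R u + (k3 + k4 * eta x) *\<^sub>R w)"
      by blast
    then have \<phi>: "D *\<^sub>R \<phi> x
        = (D * k1 + D * k2 * xi x) *\<^sub>R u + (D * k3 + D * k4 * eta x) *\<^sub>R w" for x
      by (simp add: scaleR_add_right scaleR_add_left algebra_simps)
    define \<phi>h :: "real^2 \<Rightarrow> real^2"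
      where "\<phi>h = (\<lambda>x. vector [D * k1 + D * k2 * x $ 1, D * k3 + D * k4 * x $ 2])"
    have "piola a (a + u) (a + w) \<phi>h \<phi>"
      unfolding piola_iff by (simp add: \<phi> \<phi>h_def)
    moreover have "\<phi>h \<in> Q0_ref"
      unfolding Q0_ref_iff \<phi>h_def by blast
    ultimately show "\<phi> \<in> Q0 a (a + u) (a + w)"
      unfolding Q0_def by blast
  qed
qed

text \<open>
  The Raviart-Thomas space looks the same in every affine frame: replacing \<open>x\<close> by \<open>x - a = \<xi> u + \<eta> w\<close>,
  and a linear form by one that is homogeneous in \<open>\<xi>, \<eta>\<close>, changes the term \<open>s(x) x\<close> only by affine vector
  fields.
\<close>

lemma RT_1_iff:
  "\<psi> \<in> RT 1 \<longleftrightarrow> (\<exists>p1 p2 p3 q1 q2 q3 s1 s2. \<psi> = (\<lambda>x.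
      (p1 + p2 * xi x + p3 * eta x + xi x * (s1 * xi x + s2 * eta x)) *\<^sub>R u
    + (q1 + q2 * xi x + q3 * eta x + eta x * (s1 * xi x + s2 * eta x)) *\<^sub>R w))"
  (is "_ \<longleftrightarrow> ?R")
proof
  assume "\<psi> \<in> RT 1"
  then obtain q s where \<psi>: "\<psi> = (\<lambda>x. q x + s x *\<^sub>R x)" and q: "q \<in> Pol_vec 1" and s: "s \<in> Pol_hom 1"
    by (auto simp: RT_def)
  obtain l1 l2 where "s = (\<lambda>x. l1 * x $ 1 + l2 * x $ 2)"
    using s unfolding Pol_hom_1_iff by blast
  then have "s = (\<lambda>x. 0 + l1 * x $ 1 + l2 * x $ 2)"
    by simp
  then have "s \<in> Pol 1"
    unfolding Pol_1_iff by blast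
  then obtain s0 s1 s2 where s: "s = (\<lambda>x. s0 + s1 * xi x + s2 * eta x)"
    unfolding affine_iff by blast
  have "(\<lambda>x. q x $ 1) \<in> Pol 1" "(\<lambda>x. q x $ 2) \<in> Pol 1"
    using q by (simp_all add: Pol_vec_def)
  then obtain g g1 g2 h h1 h2 where
    "(\<lambda>x. q x $ 1) = (\<lambda>x. g + g1 * xi x + g2 * eta x)"
    "(\<lambda>x. q x $ 2) = (\<lambda>x. h + h1 * xi x + h2 * eta x)"
    unfolding affine_iff by blast
  then have q12: "q x = (g + g1 * xi x + g2 * eta x) *\<^sub>R axis 1 1 + (h + h1 * xi x + h2 * eta x) *\<^sub>R axis 2 1" for x
    by (simp add: vec_eq_iff forall_2 axis_def fun_eq_iff)
  let ?c = coord_u and ?d = coord_w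
  have qx: "q x = (?c (axis 1 1) * (g + g1 * xi x + g2 * eta x) + ?c (axis 2 1) * (h + h1 * xi x + h2 * eta x)) *\<^sub>R u
     + (?d (axis 1 1) * (g + g1 * xi x + g2 * eta x) + ?d (axis 2 1) * (h + h1 * xi x + h2 * eta x)) *\<^sub>R w" for x
  proof -
    have "q x = (g + g1 * xi x + g2 * eta x) *\<^sub>R (?c (axis 1 1) *\<^sub>R u + ?d (axis 1 1) *\<^sub>R w)
        + (h + h1 * xi x + h2 * eta x) *\<^sub>R (?c (axis 2 1) *\<^sub>R u + ?d (axis 2 1) *\<^sub>R w)"
      by (simp only: frame_expansion[symmetric] q12)
    then show ?thesis
      by (simp only: scaleR_add_left scaleR_add_right scaleR_scaleR mult.commute add_ac)
  qed
  have xx: "x = (?c a + xi x) *\<^sub>R u + (?d a + eta x) *\<^sub>R w" for x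
  proof -
    have "(?c a + xi x) *\<^sub>R u + (?d a + eta x) *\<^sub>R w
        = (?c a *\<^sub>R u + ?d a *\<^sub>R w) + xi x *\<^sub>R u + eta x *\<^sub>R w"
      by (simp add: scaleR_add_left)
    then show ?thesis
      by (simp only: frame_expansion[symmetric] point_expansion[symmetric])
  qed
  have "\<psi> x = q x + s x *\<^sub>R ((?c a + xi x) *\<^sub>R u + (?d a + eta x) *\<^sub>R w)" for x
    by (simp only: \<psi> xx[symmetric])
  then have \<psi>x: "\<psi> x =
      (?c (axis 1 1) * (g + g1 * xi x + g2 * eta x) + ?c (axis 2 1) * (h + h1 * xi x + h2 * eta x)
        + s x * (?c a + xi x)) *\<^sub>R u
    + (?d (axis 1 1) * (g + g1 * xi x + g2 * eta x) + ?d (axis 2 1) * (h + h1 * xi x + h2 * eta x)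
        + s x * (?d a + eta x)) *\<^sub>R w" for x
    by (simp only: qx scaleR_add_left scaleR_add_right scaleR_scaleR distrib_left add_ac)
  have "\<psi> x =
      ((?c (axis 1 1) * g + ?c (axis 2 1) * h + s0 * ?c a)
       + (?c (axis 1 1) * g1 + ?c (axis 2 1) * h1 + s1 * ?c a + s0) * xi x
       + (?c (axis 1 1) * g2 + ?c (axis 2 1) * h2 + s2 * ?c a) * eta x
       + xi x * (s1 * xi x + s2 * eta x)) *\<^sub>R u
    + ((?d (axis 1 1) * g + ?d (axis 2 1) * h + s0 * ?d a)
       + (?d (axis 1 1) * g1 + ?d (axis 2 1) * h1 + s1 * ?d a) * xi x
       + (?d (axis 1 1) * g2 + ?d (axis 2 1) * h2 + s2 * ?d a + s0) * eta x
       + eta x * (s1 * xi x + s2 * eta x)) *\<^sub>R w" for x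
    unfolding \<psi>x s
    by (rule arg_cong2[where f = "(+)"]; rule arg_cong2[where f = "(*\<^sub>R)", OF _ refl])
      (simp_all add: algebra_simps)
  note eq = this
  show ?R
    by (intro exI ext) (rule eq)
next
  assume ?R
  then obtain p1 p2 p3 q1 q2 q3 s1 s2 where \<psi>: "\<psi> = (\<lambda>x.
      (p1 + p2 * xi x + p3 * eta x + xi x * (s1 * xi x + s2 * eta x)) *\<^sub>R u
    + (q1 + q2 * xi x + q3 * eta x + eta x * (s1 * xi x + s2 * eta x)) *\<^sub>R w)"
    by blast
  define s where "s x = s1 * coord_u x + s2 * coord_w x" for x
  define t where "t = - s a"
  have st: "s1 * xi x + s2 * eta x = s x + t" for x
    by (simp add: s_def t_def xi_def eta_def linear_diff[OF linear_coord(1)]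
        linear_diff[OF linear_coord(2)] algebra_simps)
  have s_hom: "s \<in> Pol_hom 1"
  proof -
    have "s x = (s1 * coord_u (axis 1 1) + s2 * coord_w (axis 1 1)) * x $ 1
        + (s1 * coord_u (axis 2 1) + s2 * coord_w (axis 2 1)) * x $ 2" for x
      unfolding s_def
      by (simp add: linear_axis_sum[OF linear_coord(1), of x]
          linear_axis_sum[OF linear_coord(2), of x] algebra_simps)
    then show ?thesis unfolding Pol_hom_1_iff by blast
  qed
  define q where "q x = (p1 + p2 * xi x + p3 * eta x) *\<^sub>R u + (q1 + q2 * xi x + q3 * eta x) *\<^sub>R w
    + t *\<^sub>R (xi x *\<^sub>R u + eta x *\<^sub>R w) - (s1 * xi x + s2 * eta x - t) *\<^sub>R a" for x
  have "\<psi> x = q x + s x *\<^sub>R (a + xi x *\<^sub>R u + eta x *\<^sub>R w)" for x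
    unfolding \<psi> q_def st by (simp add: algebra_simps)
  then have "\<psi> = (\<lambda>x. q x + s x *\<^sub>R x)"
    by (intro ext) (simp only: point_expansion[symmetric])
  moreover have "q \<in> Pol_vec 1"
  proof -
    have "(\<lambda>x. q x $ i) = (\<lambda>x. (p1 * u $ i + q1 * w $ i + t * a $ i)
        + (p2 * u $ i + q2 * w $ i + t * u $ i - s1 * a $ i) * xi x
        + (p3 * u $ i + q3 * w $ i + t * w $ i - s2 * a $ i) * eta x)" for i
      by (auto simp: q_def algebra_simps)
    then show ?thesis unfolding Pol_vec_def affine_iff by blast
  qed
  ultimately show "\<psi> \<in> RT 1" using s_hom unfolding RT_def by blast
qed

end

lemma linear_sym_mat: "linear sym_mat"
  by (rule linearI) (simp_all add: sym_mat_def transpose_def vec_eq_iff algebra_simps)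

lemma linear_pointwise_sym_mat: "linear (\<lambda>M (x :: 'a). sym_mat (M x))"
  by (rule linearI)
    (simp_all add: fun_eq_iff scaleR_fun_def linear_add[OF linear_sym_mat] linear_scale[OF linear_sym_mat])

lemma tensor_eq_span_outer: "tensor X Y = span {\<lambda>x. outer (\<phi> x) (\<psi> x) | \<phi> \<psi>. \<phi> \<in> X \<and> \<psi> \<in> Y}"
  by (simp add: tensor_def outer_def)

lemma sym_mat_outer_combination:
  "sym_mat (outer (k *\<^sub>R u + l *\<^sub>R w) (m *\<^sub>R u + n *\<^sub>R w))
   = (k * m) *\<^sub>R outer u u + ((k * n + l * m) / 2) *\<^sub>R (outer u w + outer w u) + (l * n) *\<^sub>R outer w w"
  by (simp add: sym_mat_def transpose_def outer_def vec_eq_iff field_simps)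

context frame
begin

text \<open>
  For one inclusion it suffices to expand the product of a general field in \<open>Q\<^sup>0\<close> and a general field
  in \<open>RT\<^sup>1\<close>. For the other one, four products suffice, one for each of the fields \<open>u\<close>, \<open>\<xi> u\<close>, \<open>w\<close>, \<open>\<eta> w\<close>
  spanning \<open>Q\<^sup>0\<close>. Coefficients of the mixed component appear doubled in them because symmetrization
  halves its products.
\<close>

lemma X_par_eq_range_shape_field: "X_par a (a + u) (a + w) = range shape_field"
proof
  let ?S = "(\<lambda>M x. sym_mat (M x)) -` range shape_field"
  have "subspace ?S"
    by (intro linear_subspace_vimage[OF linear_pointwise_sym_mat] linear_subspace_image[OF linear_shape_field]
        subspace_UNIV)
  moreover have "{\<lambda>x. outer (\<phi> x) (\<psi> x) | \<phi> \<psi>. \<phi> \<in> Q0 a (a + u) (a + w) \<and> \<psi> \<in> RT 1} \<subseteq> ?S"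
  proof safe
    fix \<phi> \<psi> assume \<phi>: "\<phi> \<in> Q0 a (a + u) (a + w)" and \<psi>: "\<psi> \<in> RT 1"
    obtain k1 k2 k3 k4 where
      \<phi>: "\<phi> = (\<lambda>x. (k1 + k2 * xi x) *\<^sub>R u + (k3 + k4 * eta x) *\<^sub>R w)"
      using \<phi> unfolding Q0_iff by blast
    obtain p1 p2 p3 q1 q2 q3 s1 s2 where \<psi>: "\<psi> = (\<lambda>x.
        (p1 + p2 * xi x + p3 * eta x + xi x * (s1 * xi x + s2 * eta x)) *\<^sub>R u
      + (q1 + q2 * xi x + q3 * eta x + eta x * (s1 * xi x + s2 * eta x)) *\<^sub>R w)"
      using \<psi> unfolding RT_1_iff by blast
    let ?p = "((k1 * p1, k1 * p2 + k2 * p1, k1 * p3, k1 * s1 + k2 * p2, k1 * s2 + k2 * p3),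
      (k3 * q1, k3 * q3 + k4 * q1, k3 * q2, k3 * s2 + k4 * q3, k3 * s1 + k4 * q2),
      ((k1 * q1 + k3 * p1) / 2, (k1 * q2 + k2 * q1 + k3 * p2) / 2, (k1 * q3 + k3 * p3 + k4 * p1) / 2,
       (k2 * q2 + k3 * s1) / 2, (k1 * s1 + k2 * q3 + k3 * s2 + k4 * p2) / 2, (k1 * s2 + k4 * p3) / 2),
      (k2 * s1, k2 * s2, k4 * s2, k4 * s1))"
    have "sym_mat (outer (\<phi> x) (\<psi> x)) = shape_field ?p x" for x
      unfolding \<phi> \<psi> sym_mat_outer_combination shape_field_def sym_field_def
      by (intro arg_cong2[where f = "(+)"] arg_cong2[where f = "(*\<^sub>R)", OF _ refl])
        (simp_all add: field_simps power2_eq_square power3_eq_cube)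
    then have "(\<lambda>x. sym_mat (outer (\<phi> x) (\<psi> x))) = shape_field ?p"
      by (rule ext)
    then show "(\<lambda>x. outer (\<phi> x) (\<psi> x)) \<in> ?S"
      by (simp only: vimage_eq rangeI)
  qed
  ultimately have "tensor (Q0 a (a + u) (a + w)) (RT 1) \<subseteq> ?S"
    unfolding tensor_eq_span_outer by (rule span_minimal[rotated])
  then show "X_par a (a + u) (a + w) \<subseteq> range shape_field"
    by (auto simp: X_par_def)
next
  show "range shape_field \<subseteq> X_par a (a + u) (a + w)"
  proof (rule image_subsetI)
    fix p :: coeffs
    obtain a1 a2 a3 a4 a5 c1 c2 c3 c4 c5 b1 b2 b3 b4 b5 b6 m1 m2 m3 m4 where
      p: "p = ((a1, a2, a3, a4, a5), (c1, c2, c3, c4, c5), (b1, b2, b3, b4, b5, b6), (m1, m2, m3, m4))"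
      by (metis surj_pair)
    define \<phi> where "\<phi> k1 k2 k3 k4 = (\<lambda>x. (k1 + k2 * xi x) *\<^sub>R u + (k3 + k4 * eta x) *\<^sub>R w)" for k1 k2 k3 k4
    define \<psi> where "\<psi> p1 p2 p3 q1 q2 q3 s1 s2 = (\<lambda>x.
        (p1 + p2 * xi x + p3 * eta x + xi x * (s1 * xi x + s2 * eta x)) *\<^sub>R u
      + (q1 + q2 * xi x + q3 * eta x + eta x * (s1 * xi x + s2 * eta x)) *\<^sub>R w)"
      for p1 p2 p3 q1 q2 q3 s1 s2
    have gen: "(\<lambda>x. outer (\<phi> k1 k2 k3 k4 x) (\<psi> p1 p2 p3 q1 q2 q3 s1 s2 x))
        \<in> tensor (Q0 a (a + u) (a + w)) (RT 1)" for k1 k2 k3 k4 p1 p2 p3 q1 q2 q3 s1 s2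
    proof -
      have "\<phi> k1 k2 k3 k4 \<in> Q0 a (a + u) (a + w)"
        unfolding Q0_iff \<phi>_def by blast
      moreover have "\<psi> p1 p2 p3 q1 q2 q3 s1 s2 \<in> RT 1"
        unfolding RT_1_iff \<psi>_def by blast
      ultimately show ?thesis
        unfolding tensor_eq_span_outer by (blast intro: span_base)
    qed
    define M1 where "M1 = (\<lambda>x. outer (\<phi> 1 0 0 0 x) (\<psi> a1 a2 a3 (2 * b1) (2 * b2) (2 * b3) 0 0 x))"
    define M2 where "M2 = (\<lambda>x. outer (\<phi> 0 1 0 0 x) (\<psi> 0 a4 a5 0 (2 * b4) (2 * b5) m1 m2 x))"
    define M3 where "M3 = (\<lambda>x. outer (\<phi> 0 0 1 0 x) (\<psi> 0 0 0 c1 c3 c2 0 0 x))"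
    define M4 where "M4 = (\<lambda>x. outer (\<phi> 0 0 0 1 x) (\<psi> 0 0 (2 * b6) 0 c5 c4 m4 m3 x))"
    have "M1 + M2 + M3 + M4 \<in> tensor (Q0 a (a + u) (a + w)) (RT 1)"
      using gen unfolding M1_def M2_def M3_def M4_def
      by (simp only: tensor_def span_add)
    moreover have "shape_field p x = sym_mat ((M1 + M2 + M3 + M4) x)" for x
    proof -
      have regroup: "(k1 *\<^sub>R X + l1 *\<^sub>R Y + n1 *\<^sub>R Z) + (k2 *\<^sub>R X + l2 *\<^sub>R Y + n2 *\<^sub>R Z)
          + (k3 *\<^sub>R X + l3 *\<^sub>R Y + n3 *\<^sub>R Z) + (k4 *\<^sub>R X + l4 *\<^sub>R Y + n4 *\<^sub>R Z)
          = (k1 + k2 + k3 + k4) *\<^sub>R X + (l1 + l2 + l3 + l4) *\<^sub>R Y + (n1 + n2 + n3 + n4) *\<^sub>R Z"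
        for k1 k2 k3 k4 l1 l2 l3 l4 n1 n2 n3 n4 and X Y Z :: "real^2^2"
        by (simp only: scaleR_add_left add_ac)
      have "sym_mat ((M1 + M2 + M3 + M4) x)
          = sym_mat (M1 x) + sym_mat (M2 x) + sym_mat (M3 x) + sym_mat (M4 x)"
        by (simp add: linear_add[OF linear_sym_mat])
      also have "\<dots> = shape_field p x"
        unfolding M1_def M2_def M3_def M4_def \<phi>_def \<psi>_def sym_mat_outer_combination regroup
          p shape_field_def sym_field_def
        by (intro arg_cong2[where f = "(+)"] arg_cong2[where f = "(*\<^sub>R)", OF _ refl])
          (simp_all add: field_simps power2_eq_square power3_eq_cube)
      finally show ?thesis ..
    qed
    ultimately show "shape_field p \<in> X_par a (a + u) (a + w)"
      unfolding X_par_def by (intro image_eqI[where x = "M1 + M2 + M3 + M4"] ext)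
  qed
qed

end

section \<open>Degrees of freedom in frame coordinates\<close>

text \<open>
  A common index type lets the three kinds of functionals be treated as one finite family.
\<close>

definition dof :: "edge set \<Rightarrow> (real^2 \<Rightarrow> real^2^2) \<Rightarrow> (edge \<times> nat) + (edge \<times> nat) + (real^2) \<Rightarrow> real"
  where "dof Es M i = (case i of
      Inl (E, k) \<Rightarrow> 1 / (edge_norm E (ell E k))\<^sup>2 * edge_inner E (tr_n E M) (ell E k)
    | Inr (Inl (E, k)) \<Rightarrow> edge_inner E (tr_t E M) (ell E k)
    | Inr (Inr z) \<Rightarrow> vertex_jump Es M z)"

context frame
begin

abbreviation "Es \<equiv> edges a (a + u) (a + u + w) (a + w)"
abbreviation "Vs \<equiv> verts a (a + u) (a + u + w) (a + w)"

lemma xi_eta_vertex [simp]: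
  "xi a = 0" "xi (a + u) = 1" "xi (a + w) = 0" "xi (a + u + w) = 1"
  "eta a = 0" "eta (a + u) = 0" "eta (a + w) = 1" "eta (a + u + w) = 1"
  using xi_eta_frame[of 0 0] xi_eta_frame[of 1 0] xi_eta_frame[of 0 1] xi_eta_frame[of 1 1]
  by simp_all

lemma xi_eta_edge_point:
  "xi (edge_point E s) = (1 - s) * xi (fst E) + s * xi (snd E)"
  "eta (edge_point E s) = (1 - s) * eta (fst E) + s * eta (snd E)"
  by (simp_all add: edge_point_def xi_def eta_def linear_coord linear_diff linear_add linear_scale
      algebra_simps)

lemma
  assumes e: "snd E - fst E = \<sigma> *\<^sub>R u" and \<sigma>: "\<bar>\<sigma>\<bar> = 1"
  shows tr_n_field_u: "tr_n E (shape_field p) x = (wedge u w / norm u)\<^sup>2 * coef_ww p (xi x) (eta x)"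
    and tMn_field_u: "tMn E (shape_field p) x
        = - wedge u w * (coef_uw p (xi x) (eta x) + (u \<bullet> w) / (u \<bullet> u) * coef_ww p (xi x) (eta x))"
    and tr_t_field_u: "tr_t E (shape_field p) x = - \<sigma> * (wedge u w / norm u)
        * (2 * coef_uw_xi p (xi x) (eta x) + coef_ww_eta p (xi x) (eta x) + (u \<bullet> w) / (u \<bullet> u) * coef_ww_xi p (xi x) (eta x))"
  unfolding shape_field_def
  by (simp_all add: tr_n_parallel[OF e \<sigma> frame_nonzero(1)] tMn_parallel[OF e \<sigma> frame_nonzero(1)]
      tr_t_parallel[OF e \<sigma> frame_nonzero(1) has_derivative_coeffs[OF has_derivative_xi_eta]])

lemma
  assumes e: "snd E - fst E = \<sigma> *\<^sub>R w" and \<sigma>: "\<bar>\<sigma>\<bar> = 1"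
  shows tr_n_field_w: "tr_n E (shape_field p) x = (wedge u w / norm w)\<^sup>2 * coef_uu p (xi x) (eta x)"
    and tMn_field_w: "tMn E (shape_field p) x
        = wedge u w * (coef_uw p (xi x) (eta x) + (w \<bullet> u) / (w \<bullet> w) * coef_uu p (xi x) (eta x))"
    and tr_t_field_w: "tr_t E (shape_field p) x = \<sigma> * (wedge u w / norm w)
        * (2 * coef_uw_eta p (xi x) (eta x) + coef_uu_xi p (xi x) (eta x) + (w \<bullet> u) / (w \<bullet> w) * coef_uu_eta p (xi x) (eta x))"
  unfolding shape_field_def sym_field_swap[of w u, symmetric]
  by (simp_all add: tr_n_parallel[OF e \<sigma> frame_nonzero(2)] tMn_parallel[OF e \<sigma> frame_nonzero(2)]
      tr_t_parallel[OF e \<sigma> frame_nonzero(2) has_derivative_coeffs(3,2,1)[OF has_derivative_xi_eta]]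
      wedge_swap[of w u])

lemma edges_mem [simp]:
  "(a, a + u) \<in> Es" "(a + u, a + u + w) \<in> Es" "(a + u + w, a + w) \<in> Es" "(a + w, a) \<in> Es"
  by (simp_all add: edges_def)

text \<open>
  On an edge parallel to \<open>u\<close> the coordinate \<open>\<eta>\<close> is constant, on the others \<open>\<xi>\<close> is; opposite edges run
  through the boundary in opposite directions.
\<close>

lemma edge_cases:
  assumes "E \<in> Es"
  obtains \<sigma> where "snd E - fst E = \<sigma> *\<^sub>R u" "\<bar>\<sigma>\<bar> = 1" "eta (fst E) = eta (snd E)"
  | \<sigma> where "snd E - fst E = \<sigma> *\<^sub>R w" "\<bar>\<sigma>\<bar> = 1" "xi (fst E) = xi (snd E)"
proof -
  consider "E = (a, a + u)" | "E = (a + u + w, a + w)" | "E = (a + u, a + u + w)" | "E = (a + w, a)"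
    using assms by (auto simp: edges_def)
  then show thesis
  proof cases
    case 1 then show thesis by (intro that(1)[of 1]) simp_all
  next
    case 2 then show thesis by (intro that(1)[of "-1"]) simp_all
  next
    case 3 then show thesis by (intro that(2)[of 1]) simp_all
  next
    case 4 then show thesis by (intro that(2)[of "-1"]) simp_all
  qed
qed

lemma edge_ends_ne: "E \<in> Es \<Longrightarrow> fst E \<noteq> snd E"
  using frame_nonzero by (elim edge_cases) auto

lemma linear_traces:
  assumes "E \<in> Es"
  shows "linear (\<lambda>p. tr_n E (shape_field p) x)" "linear (\<lambda>p. tMn E (shape_field p) x)"
    "linear (\<lambda>p. tr_t E (shape_field p) x)"
proof -
  note scale = linear_compose_scale_right[where f = "f :: coeffs \<Rightarrow> real" for f, unfolded real_scaleR_def]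
  note lin = scale linear_compose_add linear_coeffs
  show "linear (\<lambda>p. tr_n E (shape_field p) x)"
    using assms by (rule edge_cases) (simp_all only: tr_n_field_u tr_n_field_w; intro lin)+
  show "linear (\<lambda>p. tMn E (shape_field p) x)"
    using assms by (rule edge_cases) (simp_all only: tMn_field_u tMn_field_w; intro lin)+
  show "linear (\<lambda>p. tr_t E (shape_field p) x)"
    using assms by (rule edge_cases) (simp_all only: tr_t_field_u tr_t_field_w; intro lin)+
qed

text \<open>
  The component of \<open>w w\<^sup>T\<close> and its derivatives have degree at most one in \<open>\<xi>\<close>, and the mixed component has
  degree at most two in \<open>\<xi>\<close>, so that its \<open>\<xi>\<close>-derivative has degree one as well. Hence these quantities
  are affine along lines where \<open>\<eta>\<close> is constant.
\<close>

lemma edge_affine_coeffs: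
  shows "eta (fst E) = eta (snd E)
      \<Longrightarrow> edge_affine E (\<lambda>x. coef_ww p (xi x) (eta x))"
    and "eta (fst E) = eta (snd E) \<Longrightarrow> edge_affine E
      (\<lambda>x. 2 * coef_uw_xi p (xi x) (eta x) + coef_ww_eta p (xi x) (eta x) + \<kappa> * coef_ww_xi p (xi x) (eta x))"
    and "xi (fst E) = xi (snd E)
      \<Longrightarrow> edge_affine E (\<lambda>x. coef_uu p (xi x) (eta x))"
    and "xi (fst E) = xi (snd E) \<Longrightarrow> edge_affine E
      (\<lambda>x. 2 * coef_uw_eta p (xi x) (eta x) + coef_uu_xi p (xi x) (eta x) + \<kappa> * coef_uu_eta p (xi x) (eta x))"
proof -
  obtain a1 a2 a3 a4 a5 c1 c2 c3 c4 c5 b1 b2 b3 b4 b5 b6 m1 m2 m3 m4 where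
    p: "p = ((a1, a2, a3, a4, a5), (c1, c2, c3, c4, c5), (b1, b2, b3, b4, b5, b6), (m1, m2, m3, m4))"
    by (metis surj_pair)
  have const: "(1 - s) * t + s * t = t" for s t :: real
    by (simp add: algebra_simps)
  show "eta (fst E) = eta (snd E)
      \<Longrightarrow> edge_affine E (\<lambda>x. coef_ww p (xi x) (eta x))"
    "eta (fst E) = eta (snd E) \<Longrightarrow> edge_affine E
      (\<lambda>x. 2 * coef_uw_xi p (xi x) (eta x) + coef_ww_eta p (xi x) (eta x) + \<kappa> * coef_ww_xi p (xi x) (eta x))"
    "xi (fst E) = xi (snd E)
      \<Longrightarrow> edge_affine E (\<lambda>x. coef_uu p (xi x) (eta x))"
    "xi (fst E) = xi (snd E) \<Longrightarrow> edge_affine E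
      (\<lambda>x. 2 * coef_uw_eta p (xi x) (eta x) + coef_uu_xi p (xi x) (eta x) + \<kappa> * coef_uu_eta p (xi x) (eta x))"
    unfolding edge_affine_def xi_eta_edge_point p
    by (simp_all add: const) (simp_all add: algebra_simps add_divide_distrib)
qed

lemma edge_affine_cmult: "edge_affine E f \<Longrightarrow> edge_affine E (\<lambda>x. c * f x)"
  by (simp only: edge_affine_def) (simp add: distrib_left mult.left_commute)

lemma edge_affine_traces:
  assumes "E \<in> Es"
  shows "edge_affine E (tr_n E (shape_field p))" "edge_affine E (tr_t E (shape_field p))"
proof -
  have "edge_affine E (tr_n E (shape_field p)) \<and> edge_affine E (tr_t E (shape_field p))"
    using assms
  proof (cases rule: edge_cases)
    case (1 \<sigma>)
    show ?thesis
      unfolding tr_n_field_u[OF 1(1,2), abs_def] tr_t_field_u[OF 1(1,2), abs_def]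
      by (intro conjI edge_affine_cmult edge_affine_coeffs 1(3))
  next
    case (2 \<sigma>)
    show ?thesis
      unfolding tr_n_field_w[OF 2(1,2), abs_def] tr_t_field_w[OF 2(1,2), abs_def]
      by (intro conjI edge_affine_cmult edge_affine_coeffs 2(3))
  qed
  then show "edge_affine E (tr_n E (shape_field p))" "edge_affine E (tr_t E (shape_field p))" by auto
qed

lemma vertex_jump_eq:
  "vertex_jump Es M a = tMn (a + w, a) M a - tMn (a, a + u) M a"
  "vertex_jump Es M (a + u) = tMn (a, a + u) M (a + u) - tMn (a + u, a + u + w) M (a + u)"
  "vertex_jump Es M (a + u + w)
     = tMn (a + u, a + u + w) M (a + u + w) - tMn (a + u + w, a + w) M (a + u + w)"
  "vertex_jump Es M (a + w) = tMn (a + u + w, a + w) M (a + w) - tMn (a + w, a) M (a + w)"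
proof -
  have ne: "a \<noteq> a + u + w" "u \<noteq> w"
    using frame_nonzero by (simp_all add: add.assoc)
  have the: "(THE E. E \<in> Es \<and> snd E = snd E') = E'" "(THE E. E \<in> Es \<and> fst E = fst E') = E'"
    if "E' \<in> Es" for E'
    by (rule the_equality; use that ne frame_nonzero in \<open>auto simp: edges_def\<close>)+
  note edges_mem[THEN the(1)] edges_mem[THEN the(2)]
  then show
    "vertex_jump Es M a = tMn (a + w, a) M a - tMn (a, a + u) M a"
    "vertex_jump Es M (a + u) = tMn (a, a + u) M (a + u) - tMn (a + u, a + u + w) M (a + u)"
    "vertex_jump Es M (a + u + w)
       = tMn (a + u, a + u + w) M (a + u + w) - tMn (a + u + w, a + w) M (a + u + w)"
    "vertex_jump Es M (a + w) = tMn (a + u + w, a + w) M (a + w) - tMn (a + w, a) M (a + w)"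
    by (simp_all add: vertex_jump_def)
qed

abbreviation dof_index :: "((edge \<times> nat) + (edge \<times> nat) + (real^2)) set"
  where "dof_index \<equiv> (Es \<times> {0, 1}) <+> (Es \<times> {0, 1}) <+> Vs"

lemma card_dof_index: "finite dof_index" "card dof_index \<le> DIM(coeffs)"
proof -
  have fin: "finite Es" "finite Vs"
    by (simp_all add: edges_def verts_def)
  then show "finite dof_index"
    by simp
  have "card Es \<le> 4" "card Vs \<le> 4"
    unfolding edges_def verts_def by (simp_all add: card_insert_if)
  moreover have "card dof_index = 2 * card Es + (2 * card Es + card Vs)"
    using fin by (simp add: card_Plus card_cartesian_product)
  moreover have "DIM(coeffs) = 20"
    by simp
  ultimately show "card dof_index \<le> DIM(coeffs)"
    by linarith
qed

lemma linear_edge_moment: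
  assumes E: "E \<in> Es" and k: "k \<in> {0, 1}"
  shows "linear (\<lambda>p. edge_inner E (tr_n E (shape_field p)) (ell E k))"
    "linear (\<lambda>p. edge_inner E (tr_t E (shape_field p)) (ell E k))"
proof -
  note n = linear_traces(1)[OF E] and t = linear_traces(3)[OF E]
  note moments = edge_moments[OF edge_ends_ne[OF E] edge_affine_traces(1)[OF E]]
      edge_moments[OF edge_ends_ne[OF E] edge_affine_traces(2)[OF E]]
  have half: "linear (\<lambda>p. r * ((f p + g p) / m))" "linear (\<lambda>p. r * ((f p - g p) / m))"
    if "linear f" "linear g" for r m :: real and f g :: "coeffs \<Rightarrow> real"
    using linear_compose_scale_right[OF linear_compose_add[OF that], of "r / m"]
      linear_compose_scale_right[OF linear_compose_sub[OF that], of "r / m"]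
    by simp_all
  consider "k = 0" | "k = Suc 0"
    using k by auto
  then show "linear (\<lambda>p. edge_inner E (tr_n E (shape_field p)) (ell E k))"
    "linear (\<lambda>p. edge_inner E (tr_t E (shape_field p)) (ell E k))"
    by (cases; simp only: moments; intro half n t)+
qed

lemma linear_dof:
  assumes "i \<in> dof_index"
  shows "linear (\<lambda>p. dof Es (shape_field p) i)"
  using assms
proof (elim PlusE)
  fix e assume "i = Inl e" "e \<in> Es \<times> {0, 1}"
  then obtain E k where i: "i = Inl (E, k)" and Ek: "E \<in> Es" "k \<in> {0, 1}" by blast
  show ?thesis
    using linear_compose_scale_right[OF linear_edge_moment(1)[OF Ek], of "1 / (edge_norm E (ell E k))\<^sup>2"]
    by (simp add: i dof_def)
next
  fix j e assume "i = Inr j" "j = Inl e" "e \<in> Es \<times> {0, 1}"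
  then obtain E k where i: "i = Inr (Inl (E, k))" and Ek: "E \<in> Es" "k \<in> {0, 1}" by blast
  show ?thesis
    using linear_edge_moment(2)[OF Ek] by (simp add: i dof_def)
next
  fix j z assume "i = Inr j" "j = Inr z" "z \<in> Vs"
  then show ?thesis
    by (auto simp: dof_def verts_def vertex_jump_eq intro!: linear_compose_sub linear_traces)
qed

text \<open>
  The order of elimination matters: the jumps contain the diagonal components with skewness factors, and
  isolate the mixed component only after these are known to vanish at the vertices.
\<close>

lemma dof_kernel:
  assumes 0: "\<And>i. i \<in> dof_index \<Longrightarrow> dof Es (shape_field p) i = 0"
  shows "p = 0"
proof -
  define \<kappa> \<mu> where "\<kappa> = (u \<bullet> w) / (u \<bullet> u)" and "\<mu> = (w \<bullet> u) / (w \<bullet> w)"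
  have n0: "tr_n E (shape_field p) (fst E) = 0" "tr_n E (shape_field p) (snd E) = 0" if E: "E \<in> Es" for E
  proof -
    have "\<forall>k\<in>{0, 1}. edge_inner E (tr_n E (shape_field p)) (ell E k) = 0"
      using 0[of "Inl (E, k)" for k] E edge_norm_ell_pos[OF edge_ends_ne[OF E]]
      by (force simp: dof_def)
    from edge_moments_eq_0[OF edge_ends_ne[OF E] edge_affine_traces(1)[OF E] this]
    show "tr_n E (shape_field p) (fst E) = 0" "tr_n E (shape_field p) (snd E) = 0" .
  qed
  have t0: "tr_t E (shape_field p) (fst E) = 0" "tr_t E (shape_field p) (snd E) = 0" if E: "E \<in> Es" for E
  proof -
    have "\<forall>k\<in>{0, 1}. edge_inner E (tr_t E (shape_field p)) (ell E k) = 0"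
      using 0[of "Inr (Inl (E, k))" for k] E by (force simp: dof_def)
    from edge_moments_eq_0[OF edge_ends_ne[OF E] edge_affine_traces(2)[OF E] this]
    show "tr_t E (shape_field p) (fst E) = 0" "tr_t E (shape_field p) (snd E) = 0" .
  qed
  have j0: "vertex_jump Es (shape_field p) z = 0" if "z \<in> Vs" for z
    using 0[of "Inr (Inr z)"] that by (force simp: dof_def)
  have D: "wedge u w \<noteq> 0" "norm u \<noteq> 0" "norm w \<noteq> 0"
    using wedge_pos frame_nonzero by simp_all
  note Es = edges_mem
  have C: "coef_ww p 0 0 = 0" "coef_ww p 1 0 = 0" "coef_ww p 1 1 = 0" "coef_ww p 0 1 = 0"
    using n0[OF Es(1)] n0[OF Es(3)] D
    by (simp_all add: tr_n_field_u[of "(a, a + u)" 1] tr_n_field_u[of "(a + u + w, a + w)" "-1"])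
  have A: "coef_uu p 0 0 = 0" "coef_uu p 1 0 = 0" "coef_uu p 1 1 = 0" "coef_uu p 0 1 = 0"
    using n0[OF Es(2)] n0[OF Es(4)] D
    by (simp_all add: tr_n_field_w[of "(a + u, a + u + w)" 1] tr_n_field_w[of "(a + w, a)" "-1"])
  have B: "coef_uw p 0 0 = 0" "coef_uw p 1 0 = 0" "coef_uw p 1 1 = 0" "coef_uw p 0 1 = 0"
    using j0[of a] j0[of "a + u"] j0[of "a + u + w"] j0[of "a + w"] D A C
    by (simp_all add: verts_def vertex_jump_eq
        tMn_field_u[of "(a, a + u)" 1] tMn_field_u[of "(a + u + w, a + w)" "-1"]
        tMn_field_w[of "(a + u, a + u + w)" 1] tMn_field_w[of "(a + w, a)" "-1"])
  have U: "2 * coef_uw_xi p \<xi> \<eta> + coef_ww_eta p \<xi> \<eta> + \<kappa> * coef_ww_xi p \<xi> \<eta> = 0"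
    if "\<xi> \<in> {0, 1}" "\<eta> \<in> {0, 1}" for \<xi> \<eta>
    using t0[OF Es(1)] t0[OF Es(3)] D that unfolding \<kappa>_def
    by (auto simp: tr_t_field_u[of "(a, a + u)" 1] tr_t_field_u[of "(a + u + w, a + w)" "-1"])
  have W: "2 * coef_uw_eta p \<xi> \<eta> + coef_uu_xi p \<xi> \<eta> + \<mu> * coef_uu_eta p \<xi> \<eta> = 0"
    if "\<xi> \<in> {0, 1}" "\<eta> \<in> {0, 1}" for \<xi> \<eta>
    using t0[OF Es(2)] t0[OF Es(4)] D that unfolding \<mu>_def
    by (auto simp: tr_t_field_w[of "(a + u, a + u + w)" 1] tr_t_field_w[of "(a + w, a)" "-1"])
  show ?thesis
    by (rule vertex_values_determine_coeffs[of p \<kappa> \<mu>]) (use A B C U W in auto)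
qed

lemma dofs_unisolvent: "\<exists>!M. M \<in> X_par a (a + u) (a + w) \<and> (\<forall>i\<in>dof_index. dof Es M i = v i)"
proof -
  have "\<exists>!p. \<forall>i\<in>dof_index. dof Es (shape_field p) i = v i"
    by (rule functionals_unisolvent[OF card_dof_index linear_dof dof_kernel])
  then show ?thesis
    unfolding X_par_eq_range_shape_field by blast
qed

end

theorem theorem8:
  fixes K :: "(real^2) set" and a b c d :: "real^2"
  assumes "parallelogram K a b d c"
  shows "\<forall>(\<alpha> :: edge \<Rightarrow> nat \<Rightarrow> real) (\<beta> :: edge \<Rightarrow> nat \<Rightarrow> real) (\<gamma> :: real^2 \<Rightarrow> real).
    \<exists>!M. M \<in> X_par a b c \<and>
      (\<forall>E \<in> edges a b d c. \<forall>k \<in> {0, 1}.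
         1 / (edge_norm E (ell E k))\<^sup>2 * edge_inner E (tr_n E M) (ell E k) = \<alpha> E k) \<and>
      (\<forall>E \<in> edges a b d c. \<forall>k \<in> {0, 1}.
         edge_inner E (tr_t E M) (ell E k) = \<beta> E k) \<and>
      (\<forall>z \<in> verts a b d c. vertex_jump (edges a b d c) M z = \<gamma> z)"
proof (intro allI)
  fix \<alpha> \<beta> :: "edge \<Rightarrow> nat \<Rightarrow> real" and \<gamma> :: "real^2 \<Rightarrow> real"
  define u w where "u = b - a" and "w = c - a"
  have bcd: "b = a + u" "c = a + w" "d = a + u + w"
    using assms by (auto simp: parallelogram_def u_def w_def algebra_simps)
  interpret frame a u w
    using assms by unfold_locales (simp add: parallelogram_def bcd B_mat_def det_2 wedge_def mult.commute)
  have "(\<forall>i\<in>dof_index. dof Es M i = case_sum (case_prod \<alpha>) (case_sum (case_prod \<beta>) \<gamma>) i) \<longleftrightarrow>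
      (\<forall>E \<in> Es. \<forall>k \<in> {0, 1}.
         1 / (edge_norm E (ell E k))\<^sup>2 * edge_inner E (tr_n E M) (ell E k) = \<alpha> E k) \<and>
      (\<forall>E \<in> Es. \<forall>k \<in> {0, 1}. edge_inner E (tr_t E M) (ell E k) = \<beta> E k) \<and>
      (\<forall>z \<in> Vs. vertex_jump Es M z = \<gamma> z)" for M
    by (auto simp: dof_def Plus_def ball_Un)
  with dofs_unisolvent[of "case_sum (case_prod \<alpha>) (case_sum (case_prod \<beta>) \<gamma>)"]
  show "\<exists>!M. M \<in> X_par a b c \<and>
      (\<forall>E \<in> edges a b d c. \<forall>k \<in> {0, 1}.
         1 / (edge_norm E (ell E k))\<^sup>2 * edge_inner E (tr_n E M) (ell E k) = \<alpha> E k) \<and>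
      (\<forall>E \<in> edges a b d c. \<forall>k \<in> {0, 1}.
         edge_inner E (tr_t E M) (ell E k) = \<beta> E k) \<and>
      (\<forall>z \<in> verts a b d c. vertex_jump (edges a b d c) M z = \<gamma> z)"
    unfolding bcd by (simp only:)
qed

end
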